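(* Let $d\ge 1$, let $\alpha>0$ be fixed, and let $X_1,X_2,\ldots$ be i.i.d. random vectors in $\mathbb{R}^d$ having an arbitrary density $f$ with respect to Lebesgue measure. Let $(h_n)_{n\ge1}$ and $(r_n)_{n\ge 1}$ be sequences of positive numbers, and let $\tilde f_n$ be the privatised histogram estimator (defined in the context) with bandwidth $h_n$, truncation radius $r_n$ and noise level $\sigma_W=2^{3/2}\alpha^{-1}$. Assume that $r_n\to\infty$. (i) If $h_n\to 0$ and $n h_n^{2d}/\log n\to\infty$, then for Lebesgue-almost every $x\in\mathbb{R}^d$, $$\lim_{n\to\infty}\tilde f_n(x)=f(x)\quad\text{almost surely.}$$ (ii) If, in addition to the conditions of (i), $n h_n^{2d}/(r_n^{2d}\log n)\to\infty$, then $$\lim_{n\to\infty}\int_{\mathbb{R}^d}|\tilde f_n(x)-f(x)|\,dx=0\quad\text{almost surely.}$$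
   Context: Privatised histogram estimator. For each $n$, let $\{A_{h_n,1},A_{h_n,2},\ldots\}$ be a cubic partition of $\mathbb{R}^d$, i.e. a partition into cubes of side length $h_n$ (volume $h_n^d$). Let $S_n$ be the closed ball of radius $r_n$ centred at the origin, and number the cells so that $A_{h_n,j}\cap S_n\neq\emptyset$ for $j\le N_n$ and $A_{h_n,j}\cap S_n=\emptyset$ for $j>N_n$. Let $\zeta_{i,j}$ ($i,j=1,2,\ldots$) be i.i.d. random variables, independent of $(X_i)_{i\ge1}$, with the Laplace distribution of unit variance, i.e. with density $p(x)=\exp(-\sqrt2|x|)/\sqrt2$; let $H$ be the corresponding distribution function. The privatised data are $$W_{n,i,j}=\mathbb{I}_{\{X_i\in A_{h_n,j}\}}+\sigma_W\zeta_{i,j},\qquad i=1,\ldots,n,\ j\le N_n,$$ where $\sigma_W=2^{3/2}\alpha^{-1}$ and $\alpha$ is the privacy parameter. Define $$G_{n,j}(1/2)=\frac1n\sum_{i=1}^n\mathbb{I}_{\{W_{n,i,j}\le 1/2\}},\qquad \tilde\mu_n(A_{h_n,j})=\frac{H(1/(2\sigma_W))-G_{n,j}(1/2)}{1-2H(-1/(2\sigma_W))},$$ $$\tilde f_n(x)=\frac{\tilde\mu_n(A_{h_n,j})}{h_n^d}\,\mathbb{I}_{\{j\le N_n\}}\quad\text{if }x\in A_{h_n,j}.$$ *)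

theory Defs
  imports "HOL-Probability.Probability"
begin

text \<open>An axis-parallel cube of side length h: a product of intervals with endpoints
  a k and a k + h, each of which may or may not belong to the interval.\<close>

definition is_cube :: "real \<Rightarrow> (real ^ 'n) set \<Rightarrow> bool" where
  "is_cube h C \<longleftrightarrow> (\<exists>(a :: real ^ 'n) (J :: 'n \<Rightarrow> real set).
      (\<forall>k. {a $ k <..< a $ k + h} \<subseteq> J k \<and> J k \<subseteq> {a $ k .. a $ k + h}) \<and>
      C = {x. \<forall>k. x $ k \<in> J k})"

text \<open>Cells are numbered from 1; the value at index 0 is irrelevant.\<close>

definition cubic_partition :: "real \<Rightarrow> (nat \<Rightarrow> (real ^ 'n) set) \<Rightarrow> bool" where
  "cubic_partition h A \<longleftrightarrow>
     (\<forall>j\<ge>1. is_cube h (A j)) \<and> disjoint_family_on A {1..} \<and> (\<Union>j\<in>{1..}. A j) = UNIV"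

definition generated_sigma ::
    "'w measure \<Rightarrow> 'i set \<Rightarrow> ('i \<Rightarrow> 'w \<Rightarrow> 'b::topological_space) \<Rightarrow> 'w set set" where
  "generated_sigma M I Y =
     sigma_sets (space M) {Y i -` B \<inter> space M | i B. i \<in> I \<and> B \<in> sets borel}"

definition laplace_density :: "real \<Rightarrow> real" where
  "laplace_density x = exp (- sqrt 2 * \<bar>x\<bar>) / sqrt 2"

definition laplace_cdf :: "real \<Rightarrow> real" where
  "laplace_cdf = cdf (density lborel (\<lambda>x. ennreal (laplace_density x)))"

definition noise_level :: "real \<Rightarrow> real" where
  "noise_level \<alpha> = 2 powr (3/2) / \<alpha>"

text \<open>In the following definitions \<open>A\<close> is the partition, \<open>N\<close> the number of retained
  cells and \<open>h\<close> the bandwidth for one fixed sample size \<open>n\<close>; \<open>s\<close> is the noise level.\<close>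

definition privatised ::
    "(nat \<Rightarrow> (real ^ 'n) set) \<Rightarrow> real \<Rightarrow> (nat \<Rightarrow> 'w \<Rightarrow> real ^ 'n) \<Rightarrow>
     (nat \<Rightarrow> nat \<Rightarrow> 'w \<Rightarrow> real) \<Rightarrow> nat \<Rightarrow> nat \<Rightarrow> 'w \<Rightarrow> real" where
  "privatised A s X \<zeta> i j \<omega> = indicator (A j) (X i \<omega>) + s * \<zeta> i j \<omega>"

definition empirical_cdf ::
    "(nat \<Rightarrow> (real ^ 'n) set) \<Rightarrow> real \<Rightarrow> (nat \<Rightarrow> 'w \<Rightarrow> real ^ 'n) \<Rightarrow>
     (nat \<Rightarrow> nat \<Rightarrow> 'w \<Rightarrow> real) \<Rightarrow> nat \<Rightarrow> nat \<Rightarrow> real \<Rightarrow> 'w \<Rightarrow> real" where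
  "empirical_cdf A s X \<zeta> n j t \<omega> =
     (1 / real n) * (\<Sum>i=1..n. indicator {..t} (privatised A s X \<zeta> i j \<omega>))"

definition cell_estimate ::
    "(nat \<Rightarrow> (real ^ 'n) set) \<Rightarrow> real \<Rightarrow> (nat \<Rightarrow> 'w \<Rightarrow> real ^ 'n) \<Rightarrow>
     (nat \<Rightarrow> nat \<Rightarrow> 'w \<Rightarrow> real) \<Rightarrow> nat \<Rightarrow> nat \<Rightarrow> 'w \<Rightarrow> real" where
  "cell_estimate A s X \<zeta> n j \<omega> =
     (laplace_cdf (1 / (2 * s)) - empirical_cdf A s X \<zeta> n j (1/2) \<omega>)
       / (1 - 2 * laplace_cdf (- 1 / (2 * s)))"

definition cell_index :: "(nat \<Rightarrow> (real ^ 'n) set) \<Rightarrow> real ^ 'n \<Rightarrow> nat" where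
  "cell_index A x = (THE j. j \<ge> 1 \<and> x \<in> A j)"

definition private_histogram ::
    "(nat \<Rightarrow> (real ^ 'n) set) \<Rightarrow> nat \<Rightarrow> real \<Rightarrow> real \<Rightarrow> (nat \<Rightarrow> 'w \<Rightarrow> real ^ 'n) \<Rightarrow>
     (nat \<Rightarrow> nat \<Rightarrow> 'w \<Rightarrow> real) \<Rightarrow> nat \<Rightarrow> real ^ 'n \<Rightarrow> 'w \<Rightarrow> real" where
  "private_histogram A N h s X \<zeta> n x \<omega> =
     (let j = cell_index A x
      in if j \<le> N then cell_estimate A s X \<zeta> n j \<omega> / h ^ CARD('n) else 0)"

end

theory Submission
  imports Defs
begin

text \<open>
  The cell estimate \<open>m\<^sub>n(A)\<close> is an unbiased estimate of \<open>\<mu>(A)\<close> and an affine function of a mean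
  of \<open>n\<close> i.i.d. indicators, so by Hoeffding's inequality it deviates from \<open>\<mu>(A)\<close> by \<open>\<epsilon>\<close> with probability at most
  \<open>2 exp (- 2 n c\<^sup>2 \<epsilon>\<^sup>2)\<close> where \<open>c = 1 - 2 H(-1/(2 \<sigma>\<^sub>W))\<close>. With \<open>\<epsilon>\<close> of order \<open>h\<^sub>n\<^sup>d\<close>, Borel-Cantelli
  leaves only the bias \<open>\<mu>(A)/h\<^sub>n\<^sup>d - f\<close>, which vanishes at Lebesgue points; this is (i).
  For (ii), \<open>N\<^sub>n\<close> is of order at most \<open>(r\<^sub>n/h\<^sub>n)\<^sup>d\<close>, so a union bound with \<open>\<epsilon>/N\<^sub>n\<close> in each cell
  controls \<open>\<Sum>\<^sub>j \<bar>m\<^sub>n(A\<^sub>j) - \<mu>(A\<^sub>j)\<bar>\<close>, and Scheffe's lemma controls the bias in \<open>L\<^sup>1\<close>.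
\<close>

subsection \<open>Lebesgue points\<close>

text \<open>Lebesgue differentiation along cubes whose lowest corner is x, imported from the
  gauge-integral result \<open>integrable_ccontinuous_explicit\<close>. Local integrability is
  enough.\<close>

lemma AE_tendsto_corner_cube_average:
  fixes g :: "'a::euclidean_space \<Rightarrow> real"
  assumes "\<And>a b. set_integrable lborel (cbox a b) g"
  shows "AE x in lborel. ((\<lambda>h. (LINT y:cbox x (x + h *\<^sub>R One)|lborel. g y) / h ^ DIM('a)) \<longlongrightarrow> g x) (at_right 0)"
proof -
  have "g integrable_on cbox a b" for a b
    using set_borel_integral_eq_integral(1)[OF assms] .
  then obtain N where N: "negligible N"
    and lim: "\<And>x e. \<lbrakk>x \<notin> N; 0 < e\<rbrakk> \<Longrightarrow> \<exists>d>0. \<forall>h. 0 < h \<and> h < d \<longrightarrow>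
      norm (integral (cbox x (x + h *\<^sub>R One)) g /\<^sub>R h ^ DIM('a) - g x) < e"
    using integrable_ccontinuous_explicit[of g] by metis
  \<comment> \<open>A negligible set is null for the completed measure only, so it is enlarged to a
    Borel null set \<open>N'\<close> before passing to \<open>lborel\<close>.\<close>
  have "N \<in> null_sets lebesgue"
    using N by (simp add: negligible_iff_null_sets)
  then obtain N' where N': "N' \<in> null_sets lborel" "N \<subseteq> N'"
    by (auto simp: null_sets_completion_iff2)
  have "((\<lambda>h. (LINT y:cbox x (x + h *\<^sub>R One)|lborel. g y) / h ^ DIM('a)) \<longlongrightarrow> g x) (at_right 0)"
    if "x \<notin> N'" for x
  proof (rule tendstoI)
    fix e :: real assume "0 < e"
    moreover have "x \<notin> N" using that N' by auto
    ultimately obtain d where "d > 0" and d: "\<forall>h. 0 < h \<and> h < d \<longrightarrow>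
        norm (integral (cbox x (x + h *\<^sub>R One)) g /\<^sub>R h ^ DIM('a) - g x) < e"
      using lim by meson
    have "eventually (\<lambda>h::real. 0 < h \<and> h < d) (at_right 0)"
      using eventually_at_right[of 0 "1::real" "\<lambda>h. 0 < h \<and> h < d"] \<open>d > 0\<close> by auto
    then show "\<forall>\<^sub>F h in at_right 0. dist ((LINT y:cbox x (x + h *\<^sub>R One)|lborel. g y) / h ^ DIM('a)) (g x) < e"
    proof eventually_elim
      case (elim h)
      with d have "norm (integral (cbox x (x + h *\<^sub>R One)) g /\<^sub>R h ^ DIM('a) - g x) < e"
        by blast
      then show ?case
        by (simp add: set_borel_integral_eq_integral(2)[OF assms] dist_norm divide_inverse mult.commute)
    qed
  qed
  then show ?thesis
    using AE_not_in[OF N'(1)] by (auto elim!: eventually_mono)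
qed

text \<open>
  A closed cube centred at x is the union of \<open>2\<^sup>d\<close> corner cubes at x, each a reflected image of the
  upper corner cube; applying the corner version to \<open>\<bar>f \<circ> reflection - q\<bar>\<close> for all rational q
  yields Lebesgue points.
\<close>

definition reflect_coords :: "'a set \<Rightarrow> 'a::euclidean_space \<Rightarrow> 'a" where
  "reflect_coords S x = (\<Sum>j\<in>Basis. ((if j \<in> S then -1 else 1) * (x \<bullet> j)) *\<^sub>R j)"

lemma reflect_coords_inner:
  "i \<in> Basis \<Longrightarrow> reflect_coords S x \<bullet> i = (if i \<in> S then - (x \<bullet> i) else x \<bullet> i)"
  unfolding reflect_coords_def by (subst inner_sum_left_Basis) auto

lemma reflect_coords_involution [simp]: "reflect_coords S (reflect_coords S x) = x"
  by (rule euclidean_eqI) (simp add: reflect_coords_inner)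

lemma reflect_coords_measurable [measurable]: "reflect_coords S \<in> borel \<rightarrow>\<^sub>M borel"
  unfolding reflect_coords_def[abs_def] by measurable

text \<open>A reflection is diagonal with entries 1 and -1, so its Jacobian factor is a product of
  absolute values equal to 1.\<close>

lemma distr_reflect_coords: "distr lborel borel (reflect_coords S) = lborel"
proof -
  have "lborel = density (distr lborel borel (reflect_coords S)) (\<lambda>_. (\<Prod>j\<in>(Basis::'a set). \<bar>if j \<in> S then -1 else 1::real\<bar>))"
    using lborel_affine_euclidean[of "\<lambda>j. if j \<in> S then -1 else 1" "0::'a"]
    by (simp add: reflect_coords_def[abs_def])
  also have "(\<Prod>j\<in>(Basis::'a set). \<bar>if j \<in> S then -1 else 1::real\<bar>) = 1"
    by (intro prod.neutral) auto
  finally show ?thesis by (simp add: density_1)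
qed

lemma cbox_subset_UN_reflected_corners:
  fixes x :: "'a::euclidean_space"
  shows "cbox (x - h *\<^sub>R One) (x + h *\<^sub>R One) \<subseteq>
    (\<Union>S\<in>Pow Basis. reflect_coords S -` cbox (reflect_coords S x) (reflect_coords S x + h *\<^sub>R One))"
proof
  fix z assume z: "z \<in> cbox (x - h *\<^sub>R One) (x + h *\<^sub>R One)"
  \<comment> \<open>Reflecting exactly the coordinates in which z lies below x makes the image of z
    dominate the image of x in every coordinate.\<close>
  let ?S = "{i\<in>Basis. z \<bullet> i < x \<bullet> i}"
  have "reflect_coords ?S z \<in> cbox (reflect_coords ?S x) (reflect_coords ?S x + h *\<^sub>R One)"
    using z by (auto simp: mem_box reflect_coords_inner inner_simps)
  then show "z \<in> (\<Union>S\<in>Pow Basis. reflect_coords S -` cbox (reflect_coords S x) (reflect_coords S x + h *\<^sub>R One))"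
    by (intro UN_I[of ?S]) auto
qed

lemma AE_lebesgue_point:
  fixes f :: "'a::euclidean_space \<Rightarrow> real"
  assumes f: "integrable lborel f"
  shows "AE x in lborel. ((\<lambda>h. (LINT z:cbox (x - h *\<^sub>R One) (x + h *\<^sub>R One)|lborel. \<bar>f z - f x\<bar>) / h ^ DIM('a)) \<longlongrightarrow> 0) (at_right 0)"
proof -
  have fm[measurable]: "f \<in> borel_measurable borel"
    using borel_measurable_integrable[OF f] by simp
  define B where "B S x h = reflect_coords S -` cbox (reflect_coords S x) (reflect_coords S x + h *\<^sub>R One)"
    for S and x :: 'a and h :: real
  have B_sets[measurable]: "B S x h \<in> sets borel" for S x h
    unfolding B_def using measurable_sets[OF reflect_coords_measurable, of "cbox _ _"] by simp
  have intc: "set_integrable lborel (cbox a b) (\<lambda>_. c)" for a b :: 'a and c :: real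
    unfolding set_integrable_def using emeasure_lborel_cbox_finite[of a b]
    by (intro integrable_scaleR_left) (auto simp: integrable_indicator_iff simp flip: infinity_ennreal_def)
  have intq: "set_integrable lborel (cbox a b) (\<lambda>y. \<bar>f y - q\<bar>)" for a b q
  proof -
    have "set_integrable lborel (cbox a b) f"
      using f unfolding set_integrable_def by (intro integrable_mult_indicator) auto
    then show ?thesis using intc by (intro set_integrable_abs set_integral_diff) auto
  qed
  have "AE x in lborel. ((\<lambda>h. (LINT z:B S x h|lborel. \<bar>f z - q\<bar>) / h ^ DIM('a)) \<longlongrightarrow> \<bar>f x - q\<bar>) (at_right 0)"
    for q :: real and S
  proof -
    let ?g = "\<lambda>y. \<bar>f (reflect_coords S y) - q\<bar>"
    have "set_integrable lborel (cbox a b) ?g" for a b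
    proof -
      have "integrable (distr lborel borel (reflect_coords S)) f"
        using f by (simp add: distr_reflect_coords)
      then have "integrable lborel (\<lambda>y. f (reflect_coords S y))"
        by (subst (asm) integrable_distr_eq) auto
      then have "set_integrable lborel (cbox a b) (\<lambda>y. f (reflect_coords S y))"
        unfolding set_integrable_def by (intro integrable_mult_indicator) auto
      then show ?thesis using intc by (intro set_integrable_abs set_integral_diff) auto
    qed
    \<comment> \<open>The corner version holds at almost every point; invariance of Lebesgue measure
      under the reflection transports this to the reflected point \<open>reflect_coords S x\<close>,
      where \<open>?g\<close> takes the value |f x - q|.\<close>
    from AE_tendsto_corner_cube_average[OF this]
    have "AE x in distr lborel borel (reflect_coords S).
      ((\<lambda>h. (LINT y:cbox x (x + h *\<^sub>R One)|lborel. ?g y) / h ^ DIM('a)) \<longlongrightarrow> ?g x) (at_right 0)"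
      by (subst distr_reflect_coords)
    then have "AE x in lborel. ((\<lambda>h. (LINT y:cbox (reflect_coords S x) (reflect_coords S x + h *\<^sub>R One)|lborel. ?g y) / h ^ DIM('a))
        \<longlongrightarrow> ?g (reflect_coords S x)) (at_right 0)"
      by (rule AE_distrD[where P = "\<lambda>x. ((\<lambda>h. (LINT y:cbox x (x + h *\<^sub>R One)|lborel. ?g y) / h ^ DIM('a)) \<longlongrightarrow> ?g x) (at_right 0)", rotated]) simp
    moreover have "(LINT y:cbox (reflect_coords S x) (reflect_coords S x + h *\<^sub>R One)|lborel. ?g y) =
      (LINT z:B S x h|lborel. \<bar>f z - q\<bar>)" for x h
    proof -
      have "(LINT z:B S x h|lborel. \<bar>f z - q\<bar>) =
        (LINT z|distr lborel borel (reflect_coords S). indicator (B S x h) z * \<bar>f z - q\<bar>)"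
        by (simp add: set_lebesgue_integral_def distr_reflect_coords)
      also have "\<dots> = (LINT y|lborel. indicator (B S x h) (reflect_coords S y) * ?g y)"
        by (subst integral_distr) auto
      also have "\<dots> = (LINT y:cbox (reflect_coords S x) (reflect_coords S x + h *\<^sub>R One)|lborel. ?g y)"
        by (simp add: set_lebesgue_integral_def B_def indicator_def)
      finally show ?thesis by simp
    qed
    ultimately show ?thesis by simp
  qed
  \<comment> \<open>The exceptional null set depends on q and S. Rational q and subsets of the
    finite basis leave countably many of them, so a single null set serves all.\<close>
  then have "AE x in lborel. \<forall>q\<in>\<rat>. \<forall>S\<in>Pow Basis.
      ((\<lambda>h. (LINT z:B S x h|lborel. \<bar>f z - q\<bar>) / h ^ DIM('a)) \<longlongrightarrow> \<bar>f x - q\<bar>) (at_right 0)"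
    by (intro AE_ball_countable') (auto intro!: countable_finite countable_rat)
  then show ?thesis
  proof (rule AE_mp, intro AE_I2 impI)
    fix x :: 'a
    assume lim: "\<forall>q\<in>\<rat>. \<forall>S\<in>Pow Basis.
      ((\<lambda>h. (LINT z:B S x h|lborel. \<bar>f z - q\<bar>) / h ^ DIM('a)) \<longlongrightarrow> \<bar>f x - q\<bar>) (at_right 0)"
    \<comment> \<open>\<open>D\<close> has two roles: it counts the corner cubes, and
      \<open>D * h^d\<close> is the volume of the centred cube, which has side 2h.\<close>
    define D :: real where "D = 2 ^ DIM('a)"
    have "D > 0" by (simp add: D_def)
    let ?C = "\<lambda>h. cbox (x - h *\<^sub>R One) (x + h *\<^sub>R One)"
    show "((\<lambda>h. (LINT z:?C h|lborel. \<bar>f z - f x\<bar>) / h ^ DIM('a)) \<longlongrightarrow> 0) (at_right 0)"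
    proof (rule tendstoI)
      fix e :: real assume "e > 0"
      \<comment> \<open>The constant q stands in for f x. The error 2 D |f x - q| has one half from
        the limits at the \<open>D\<close> corners and one half from replacing f x by q under the
        integral; with this q it is below e/2.\<close>
      obtain q where q: "q \<in> \<rat>" "f x < q" "q < f x + e / (4 * D)"
        using Rats_dense_in_real[of "f x" "f x + e / (4 * D)"] \<open>e > 0\<close> \<open>D > 0\<close> by auto
      have "((\<lambda>h. (\<Sum>S\<in>Pow Basis. (LINT z:B S x h|lborel. \<bar>f z - q\<bar>) / h ^ DIM('a)) + D * \<bar>f x - q\<bar>)
          \<longlongrightarrow> (\<Sum>S\<in>Pow (Basis::'a set). \<bar>f x - q\<bar>) + D * \<bar>f x - q\<bar>) (at_right 0)"
        using lim q(1) by (intro tendsto_intros) auto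
      also have "(\<Sum>S\<in>Pow (Basis::'a set). \<bar>f x - q\<bar>) + D * \<bar>f x - q\<bar> = 2 * D * \<bar>f x - q\<bar>"
        by (simp add: card_Pow D_def)
      finally have "eventually (\<lambda>h. (\<Sum>S\<in>Pow Basis. (LINT z:B S x h|lborel. \<bar>f z - q\<bar>) / h ^ DIM('a)) + D * \<bar>f x - q\<bar> < e) (at_right 0)"
        by (rule order_tendstoD) (use q \<open>D > 0\<close> \<open>e > 0\<close> in \<open>auto simp: abs_if field_simps\<close>)
      moreover have "eventually (\<lambda>h::real. 0 < h) (at_right 0)"
        by (simp add: eventually_at_right_less)
      ultimately show "\<forall>\<^sub>F h in at_right 0. dist ((LINT z:?C h|lborel. \<bar>f z - f x\<bar>) / h ^ DIM('a)) 0 < e"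
      proof eventually_elim
        case (elim h)
        have vol: "measure lborel (?C h) = D * h ^ DIM('a)"
          using \<open>0 < h\<close> by (simp add: measure_lborel_cbox_eq inner_simps D_def power_mult_distrib)
        have Bint: "set_integrable lborel (B S x h) (\<lambda>z. \<bar>f z - q\<bar>)" if "S \<in> Pow Basis" for S
        proof (rule set_integrable_subset[OF intq])
          show "B S x h \<subseteq> ?C h"
            using that by (force simp: B_def mem_box reflect_coords_inner inner_simps split: if_splits)
        qed auto
        have "(LINT z:?C h|lborel. \<bar>f z - f x\<bar>) \<le> (LINT z:?C h|lborel. \<bar>f z - q\<bar> + \<bar>f x - q\<bar>)"
          by (intro set_integral_mono intq set_integral_add intc) auto
        also have "\<dots> = (LINT z:?C h|lborel. \<bar>f z - q\<bar>) + (LINT z:?C h|lborel. \<bar>f x - q\<bar>)"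
          by (intro set_integral_add intq intc)
        also have "(LINT z:?C h|lborel. \<bar>f x - q\<bar>) = D * h ^ DIM('a) * \<bar>f x - q\<bar>"
          by (simp add: set_lebesgue_integral_def vol)
        \<comment> \<open>The corner cubes cover the centred cube. Overlaps only increase the
          right-hand side because the integrand is nonnegative.\<close>
        also have "(LINT z:?C h|lborel. \<bar>f z - q\<bar>) \<le> (\<Sum>S\<in>Pow Basis. (LINT z:B S x h|lborel. \<bar>f z - q\<bar>))"
        proof -
          have "(LINT z:?C h|lborel. \<bar>f z - q\<bar>) \<le>
            (LINT z|lborel. (\<Sum>S\<in>Pow Basis. indicator (B S x h) z *\<^sub>R \<bar>f z - q\<bar>))"
            unfolding set_lebesgue_integral_def
          proof (rule integral_mono)
            show "integrable lborel (\<lambda>z. indicator (?C h) z *\<^sub>R \<bar>f z - q\<bar>)"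
              using intq unfolding set_integrable_def .
            show "integrable lborel (\<lambda>z. \<Sum>S\<in>Pow Basis. indicator (B S x h) z *\<^sub>R \<bar>f z - q\<bar>)"
              using Bint unfolding set_integrable_def by (rule Bochner_Integration.integrable_sum)
            fix z
            show "indicator (?C h) z *\<^sub>R \<bar>f z - q\<bar> \<le> (\<Sum>S\<in>Pow Basis. indicator (B S x h) z *\<^sub>R \<bar>f z - q\<bar>)"
            proof (cases "z \<in> ?C h")
              case True
              then obtain S where S: "S \<in> Pow Basis" "z \<in> B S x h"
                using cbox_subset_UN_reflected_corners[of x h] unfolding B_def by blast
              have "indicator (B S x h) z *\<^sub>R \<bar>f z - q\<bar> \<le> (\<Sum>S\<in>Pow Basis. indicator (B S x h) z *\<^sub>R \<bar>f z - q\<bar>)"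
                by (rule member_le_sum[OF S(1)]) auto
              then show ?thesis using True S by simp
            qed (auto intro!: sum_nonneg)
          qed
          also have "\<dots> = (\<Sum>S\<in>Pow Basis. (LINT z:B S x h|lborel. \<bar>f z - q\<bar>))"
            unfolding set_lebesgue_integral_def
            using Bint unfolding set_integrable_def by (rule Bochner_Integration.integral_sum)
          finally show ?thesis .
        qed
        finally have "(LINT z:?C h|lborel. \<bar>f z - f x\<bar>) / h ^ DIM('a) \<le>
            ((\<Sum>S\<in>Pow Basis. (LINT z:B S x h|lborel. \<bar>f z - q\<bar>)) + D * h ^ DIM('a) * \<bar>f x - q\<bar>) / h ^ DIM('a)"
          using \<open>0 < h\<close> by (intro divide_right_mono) auto
        also have "\<dots> = (\<Sum>S\<in>Pow Basis. (LINT z:B S x h|lborel. \<bar>f z - q\<bar>) / h ^ DIM('a)) + D * \<bar>f x - q\<bar>"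
          using \<open>0 < h\<close> by (simp add: add_divide_distrib sum_divide_distrib)
        also have "\<dots> < e" by fact
        finally show ?case
          using \<open>0 < h\<close> by (simp add: set_lebesgue_integral_def)
      qed
    qed
  qed
qed

subsection \<open>Cubic partitions\<close>

text \<open>Squeezing a cube between an open and a closed box of equal volume allows its measure and
  extent to be computed without knowing which faces belong to it.\<close>

lemma is_cube_between_boxes:
  fixes C :: "(real ^ 'n) set"
  assumes "is_cube h C"
  obtains a where "box a (a + h *\<^sub>R One) \<subseteq> C" "C \<subseteq> cbox a (a + h *\<^sub>R One)"
proof -
  obtain a :: "real ^ 'n" and J where J: "\<And>k. {a $ k <..< a $ k + h} \<subseteq> J k" "\<And>k. J k \<subseteq> {a $ k .. a $ k + h}"
    and C: "C = {x. \<forall>k. x $ k \<in> J k}"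
    using assms unfolding is_cube_def by blast
  have One: "(One :: real ^ 'n) $ k = 1" for k
    by (rule trans[OF cart_eq_inner_axis]) (simp add: axis_in_Basis_iff)
  show thesis
  proof
    show "box a (a + h *\<^sub>R One) \<subseteq> C"
    proof
      fix x assume "x \<in> box a (a + h *\<^sub>R One)"
      then have "x $ k \<in> {a $ k <..< a $ k + h}" for k
        by (simp add: mem_box_cart One del: sum_component)
      then show "x \<in> C" unfolding C using J(1) by blast
    qed
    show "C \<subseteq> cbox a (a + h *\<^sub>R One)"
    proof
      fix x assume "x \<in> C"
      then have "x $ k \<in> {a $ k .. a $ k + h}" for k
        unfolding C using J(2) by blast
      then show "x \<in> cbox a (a + h *\<^sub>R One)"
        by (simp add: mem_box_cart One del: sum_component)
    qed
  qed
qed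

text \<open>Such a set differs from the open interval by at most the two endpoints.\<close>

lemma sets_borel_between_Ioo_Icc:
  fixes a b :: real
  assumes "{a<..<b} \<subseteq> J" "J \<subseteq> {a..b}"
  shows "J \<in> sets borel"
proof -
  have "J = {a<..<b} \<union> (J \<inter> {a, b})"
    using assms by force
  moreover have "J \<inter> {a, b} \<in> sets borel"
    by (intro borel_closed finite_imp_closed) auto
  ultimately show ?thesis
    by (metis borel_open open_greaterThanLessThan sets.Un)
qed

lemma is_cube_sets_borel:
  fixes C :: "(real ^ 'n) set"
  assumes "is_cube h C"
  shows "C \<in> sets borel"
proof -
  obtain a :: "real ^ 'n" and J where J: "\<And>k. {a $ k <..< a $ k + h} \<subseteq> J k" "\<And>k. J k \<subseteq> {a $ k .. a $ k + h}"
    and C: "C = {x. \<forall>k. x $ k \<in> J k}"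
    using assms unfolding is_cube_def by blast
  have [measurable]: "J k \<in> sets borel" for k
    by (rule sets_borel_between_Ioo_Icc[OF J])
  have [measurable]: "(\<lambda>x::real^'n. x $ k) \<in> borel_measurable borel" for k
    by (intro borel_measurable_continuous_onI continuous_intros)
  have "{x \<in> space borel. \<forall>k. x $ k \<in> J k} \<in> sets borel"
    by measurable
  then show ?thesis by (simp add: C)
qed

lemma emeasure_is_cube:
  fixes C :: "(real ^ 'n) set"
  assumes "is_cube h C" "h > 0"
  shows "emeasure lborel C = ennreal (h ^ CARD('n))"
proof -
  obtain a where a: "box a (a + h *\<^sub>R One) \<subseteq> C" "C \<subseteq> cbox a (a + h *\<^sub>R One)"
    using is_cube_between_boxes[OF assms(1)] .
  have "emeasure lborel (box a (a + h *\<^sub>R One)) = ennreal (h ^ CARD('n))"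
    using assms(2) by (simp add: emeasure_lborel_box_eq inner_simps)
  moreover have "emeasure lborel (cbox a (a + h *\<^sub>R One)) = ennreal (h ^ CARD('n))"
    using assms(2) by (simp add: emeasure_lborel_cbox_eq inner_simps)
  ultimately show ?thesis
    using emeasure_mono[OF a(1), of lborel] emeasure_mono[OF a(2), of lborel]
      is_cube_sets_borel[OF assms(1)] by (simp add: antisym)
qed

lemma measure_is_cube:
  fixes C :: "(real ^ 'n) set"
  assumes "is_cube h C" "h > 0"
  shows "measure lborel C = h ^ CARD('n)"
  using emeasure_is_cube[OF assms] assms(2) by (simp add: measure_def)

text \<open>Two points of a cube differ by at most h in each coordinate. The point x may sit
  anywhere in its cell, hence the centred cube of side 2h, which is the shape used in
  \<open>AE_lebesgue_point\<close>.\<close>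

lemma is_cube_subset_cbox:
  fixes C :: "(real ^ 'n) set"
  assumes "is_cube h C" "x \<in> C"
  shows "C \<subseteq> cbox (x - h *\<^sub>R One) (x + h *\<^sub>R One)"
proof -
  obtain a where a: "C \<subseteq> cbox a (a + h *\<^sub>R One)"
    using is_cube_between_boxes[OF assms(1)] .
  show ?thesis
  proof
    fix z assume "z \<in> C"
    then have zx: "z \<in> cbox a (a + h *\<^sub>R One)" "x \<in> cbox a (a + h *\<^sub>R One)"
      using a assms(2) by auto
    show "z \<in> cbox (x - h *\<^sub>R One) (x + h *\<^sub>R One)"
      unfolding mem_box
    proof
      fix i :: "real ^ 'n" assume i: "i \<in> Basis"
      then show "(x - h *\<^sub>R One) \<bullet> i \<le> z \<bullet> i \<and> z \<bullet> i \<le> (x + h *\<^sub>R One) \<bullet> i"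
        using zx[unfolded mem_box, rule_format, OF i] by (simp add: inner_simps)
    qed
  qed
qed

lemma cubic_partition_cell:
  assumes "cubic_partition h A" "j \<ge> 1"
  shows "is_cube h (A j)"
  using assms unfolding cubic_partition_def by blast

lemma cell_index_eq:
  assumes "cubic_partition h A" "j \<ge> 1" "x \<in> A j"
  shows "cell_index A x = j"
  unfolding cell_index_def
proof (rule the_equality)
  fix k assume k: "k \<ge> 1 \<and> x \<in> A k"
  show "k = j"
  proof (rule ccontr)
    assume "k \<noteq> j"
    then have "A k \<inter> A j = {}"
      using assms k unfolding cubic_partition_def disjoint_family_on_def by auto
    then show False using k assms(3) by blast
  qed
qed (use assms in auto)

lemma cell_index:
  assumes "cubic_partition h A"
  shows "cell_index A x \<ge> 1" "x \<in> A (cell_index A x)"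
proof -
  have "x \<in> (\<Union>j\<in>{1..}. A j)"
    using assms unfolding cubic_partition_def by blast
  then obtain j where "j \<ge> 1" "x \<in> A j" by auto
  then show "cell_index A x \<ge> 1" "x \<in> A (cell_index A x)"
    using cell_index_eq[OF assms] by auto
qed

text \<open>Volume count: the first \<open>N\<close> cells are disjoint, have volume
  \<open>h^d\<close> each, and lie in a centred cube of side 2(r + h) because each meets the
  ball.\<close>

lemma number_of_cells_le:
  fixes A :: "nat \<Rightarrow> (real ^ 'n) set"
  assumes A: "cubic_partition h A" and h: "h > 0" and r: "r \<ge> 0"
    and N: "\<And>j. j \<ge> 1 \<Longrightarrow> j \<le> N \<Longrightarrow> A j \<inter> cball 0 r \<noteq> {}"
  shows "real N * h ^ CARD('n) \<le> (2 * (r + h)) ^ CARD('n)"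
proof -
  let ?B = "cbox (- ((r + h) *\<^sub>R One)) ((r + h) *\<^sub>R One) :: (real ^ 'n) set"
  have sub: "A j \<subseteq> ?B" if "j \<in> {1..N}" for j
  proof -
    obtain y where y: "y \<in> A j" "norm y \<le> r"
      using N[of j] \<open>j \<in> {1..N}\<close> by auto
    have "cbox (y - h *\<^sub>R One) (y + h *\<^sub>R One) \<subseteq> ?B"
      unfolding subset_box
    proof (intro disjI1 ballI conjI impI)
      fix i :: "real ^ 'n" assume i: "i \<in> Basis"
      then have "\<bar>y \<bullet> i\<bar> \<le> r" using Basis_le_norm[OF i, of y] y by linarith
      then show "- ((r + h) *\<^sub>R One) \<bullet> i \<le> (y - h *\<^sub>R One) \<bullet> i" "(y + h *\<^sub>R One) \<bullet> i \<le> (r + h) *\<^sub>R One \<bullet> i"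
        using i by (auto simp: inner_simps)
    qed
    then show ?thesis
      using is_cube_subset_cbox[OF cubic_partition_cell[OF A] y(1)] that by auto
  qed
  have "ennreal (real N * h ^ CARD('n)) = (\<Sum>j\<in>{1..N}. emeasure lborel (A j))"
    using h emeasure_is_cube[OF cubic_partition_cell[OF A] h]
    by (simp add: ennreal_mult ennreal_of_nat_eq_real_of_nat)
  also have "\<dots> = emeasure lborel (\<Union>j\<in>{1..N}. A j)"
  proof (rule sum_emeasure)
    show "disjoint_family_on A {1..N}"
      using A unfolding cubic_partition_def by (auto intro: disjoint_family_on_mono[rotated])
    show "A ` {1..N} \<subseteq> sets lborel"
      using is_cube_sets_borel[OF cubic_partition_cell[OF A]] by auto
  qed simp
  also have "\<dots> \<le> emeasure lborel ?B"
    using sub by (intro emeasure_mono UN_least) auto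
  also have "\<dots> = ennreal ((2 * (r + h)) ^ CARD('n))"
  proof -
    have "((r + h) *\<^sub>R One) \<bullet> i = r + h" if "i \<in> Basis" for i :: "real ^ 'n"
      using that by (simp add: inner_simps)
    then have "(- ((r + h) *\<^sub>R One)) \<bullet> i \<le> ((r + h) *\<^sub>R One) \<bullet> i"
        "(((r + h) *\<^sub>R One) - (- ((r + h) *\<^sub>R One))) \<bullet> i = 2 * (r + h)"
      if "i \<in> Basis" for i :: "real ^ 'n"
      using that h r unfolding inner_diff_left inner_minus_left by auto
    then show ?thesis
      unfolding emeasure_lborel_cbox_eq by (subst if_P) simp_all
  qed
  finally show ?thesis
    using h r by (simp add: ennreal_le_iff)
qed

text \<open>By disjointness only the summand of the cell containing x survives. This links pointwise
  arguments, phrased with \<open>cell_index\<close>, to integrals, which are computed cell by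
  cell.\<close>

lemma sum_indicator_cells:
  fixes a :: "nat \<Rightarrow> real"
  assumes "cubic_partition h A"
  shows "(\<Sum>j=1..N. a j * indicator (A j) x) = (if cell_index A x \<le> N then a (cell_index A x) else 0)"
proof -
  let ?k = "cell_index A x"
  have "indicator (A j) x = (if j = ?k then 1 else 0 :: real)" if "j \<ge> 1" for j
  proof (cases "x \<in> A j")
    case True
    then show ?thesis using cell_index_eq[OF assms that True] by simp
  next
    case False
    then have "j \<noteq> ?k" using cell_index(2)[OF assms, of x] by metis
    then show ?thesis using False by simp
  qed
  then have "(\<Sum>j=1..N. a j * indicator (A j) x) = (\<Sum>j=1..N. if j = ?k then a j else 0)"
    by (intro sum.cong) auto
  then show ?thesis
    using cell_index(1)[OF assms, of x] by simp
qed

lemma private_histogram_eq_sum: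
  fixes A :: "nat \<Rightarrow> (real ^ 'n) set"
  assumes "cubic_partition h A"
  shows "private_histogram A N h s X \<zeta> n x \<omega> =
    (\<Sum>j=1..N. cell_estimate A s X \<zeta> n j \<omega> / h ^ CARD('n) * indicator (A j) x)"
  unfolding sum_indicator_cells[OF assms] private_histogram_def Let_def ..

subsection \<open>The Laplace distribution\<close>

abbreviation laplace_measure :: "real measure" where
  "laplace_measure \<equiv> density lborel (\<lambda>x. ennreal (laplace_density x))"

lemma laplace_density_pos: "0 < laplace_density x"
  by (simp add: laplace_density_def)

lemma laplace_density_measurable [measurable]: "laplace_density \<in> borel_measurable borel"
  unfolding laplace_density_def[abs_def] by measurable

text \<open>Substitute -x for x and use that the density is even.\<close>

lemma laplace_cdf_minus:
  assumes "prob_space laplace_measure"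
  shows "laplace_cdf (- t) = 1 - laplace_cdf t"
proof -
  interpret L: prob_space laplace_measure by fact
  have "emeasure laplace_measure {..- t} = (\<integral>\<^sup>+x. ennreal (laplace_density x) * indicator {..- t} x \<partial>lborel)"
    by (simp add: emeasure_density)
  also have "\<dots> = (\<integral>\<^sup>+x. ennreal (laplace_density (- x)) * indicator {..- t} (- x) \<partial>lborel)"
    by (subst nn_integral_real_affine[where c = "-1" and t = 0]) auto
  also have "\<dots> = (\<integral>\<^sup>+x. ennreal (laplace_density x) * indicator {t<..} x \<partial>lborel)"
  proof (rule nn_integral_cong_AE)
    \<comment> \<open>The reflected half-line is closed at t and the other one open; they differ in
      the null set {t}.\<close>
    show "AE x in lborel. ennreal (laplace_density (- x)) * indicator {..- t} (- x) =
        ennreal (laplace_density x) * indicator {t<..} x"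
      using AE_lborel_singleton[of t]
      by eventually_elim (auto simp: laplace_density_def indicator_def)
  qed
  also have "\<dots> = emeasure laplace_measure {t<..}"
    by (simp add: emeasure_density)
  also have "{t<..} = space laplace_measure - {..t}"
    by auto
  finally have "measure laplace_measure {..- t} = measure laplace_measure (space laplace_measure - {..t})"
    by (simp add: measure_def)
  also have "\<dots> = 1 - measure laplace_measure {..t}"
    by (rule L.prob_compl) simp
  finally show ?thesis
    by (simp add: laplace_cdf_def cdf_def)
qed

text \<open>The density is positive everywhere, so a nondegenerate interval cannot have mass 0. This
  later makes the denominator of the cell estimate positive.\<close>

lemma laplace_cdf_strict_mono:
  assumes "prob_space laplace_measure" "t < u"
  shows "laplace_cdf t < laplace_cdf u"
proof -
  interpret L: prob_space laplace_measure by fact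
  have "{t<..u} \<notin> null_sets laplace_measure"
  proof
    assume "{t<..u} \<in> null_sets laplace_measure"
    then have "AE x in lborel. x \<notin> {t<..u}"
      using laplace_density_pos
      by (subst (asm) null_sets_density_iff) (auto simp: not_le not_less[symmetric] ennreal_eq_0_iff elim!: eventually_mono)
    then have "{t<..u} \<in> null_sets lborel"
      by (subst (asm) AE_iff_null) (auto simp: greaterThanAtMost_def greaterThan_def atMost_def Int_def)
    then show False using \<open>t < u\<close> by (simp add: null_sets_def)
  qed
  then have "0 < measure laplace_measure {t<..u}"
    by (simp add: null_sets_def L.emeasure_eq_measure zero_less_measure_iff)
  also have "{t<..u} = {..u} - {..t}" by auto
  also have "measure laplace_measure \<dots> = measure laplace_measure {..u} - measure laplace_measure {..t}"
    using \<open>t < u\<close> by (intro L.finite_measure_Diff) auto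
  finally show ?thesis by (simp add: laplace_cdf_def cdf_def)
qed

subsection \<open>Independence of pairs from two independent families\<close>

lemma Int_stable_vimages: "Int_stable {V -` B \<inter> S | B. B \<in> sets N}"
proof (rule Int_stableI)
  fix a b assume "a \<in> {V -` B \<inter> S | B. B \<in> sets N}" "b \<in> {V -` B \<inter> S | B. B \<in> sets N}"
  then obtain B C where "a = V -` B \<inter> S" "b = V -` C \<inter> S" "B \<in> sets N" "C \<in> sets N"
    by auto
  then show "a \<inter> b \<in> {V -` B \<inter> S | B. B \<in> sets N}"
    by (intro CollectI exI[of _ "B \<inter> C"]) auto
qed

context prob_space
begin

lemma indep_sets_events: "indep_sets F I \<Longrightarrow> i \<in> I \<Longrightarrow> F i \<subseteq> events"
  unfolding indep_sets_def by blast

text \<open>A finite intersection over the disjoint sum splits into an \<open>F\<close>-part in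
  \<open>S\<close> and a \<open>G\<close>-part in \<open>T\<close>. Independence of \<open>S\<close>
  and \<open>T\<close> separates the two parts, and independence within each family factors them
  further.\<close>

lemma indep_sets_Plus:
  assumes F: "indep_sets F I" "\<And>i. i \<in> I \<Longrightarrow> F i \<subseteq> S"
    and G: "indep_sets G K" "\<And>k. k \<in> K \<Longrightarrow> G k \<subseteq> T"
    and ST: "indep_set S T" "sigma_algebra (space M) S" "sigma_algebra (space M) T"
  shows "indep_sets (case_sum F G) (I <+> K)"
proof (rule indep_setsI)
  show events: "case_sum F G x \<subseteq> events" if "x \<in> I <+> K" for x
    using that by (auto dest: indep_sets_events[OF F(1), THEN subsetD] indep_sets_events[OF G(1), THEN subsetD])

  \<comment> \<open>Intersecting with \<open>space M\<close> covers an empty \<open>J\<close>: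
    either part of the split may be empty, and its event is then \<open>space M\<close>, of
    probability 1.\<close>
  have inter: "prob (space M \<inter> (\<Inter>j\<in>J. A j)) = (\<Prod>j\<in>J. prob (A j)) \<and> space M \<inter> (\<Inter>j\<in>J. A j) \<in> R"
    if H: "indep_sets H L" "\<And>i. i \<in> L \<Longrightarrow> H i \<subseteq> R" "sigma_algebra (space M) R"
      and J: "finite J" "J \<subseteq> L" "\<And>j. j \<in> J \<Longrightarrow> A j \<in> H j"
    for H L R J and A :: "'e \<Rightarrow> 'a set"
  proof
    interpret R: sigma_algebra "space M" R by fact
    show "space M \<inter> (\<Inter>j\<in>J. A j) \<in> R"
      using J
    proof (induction J rule: finite_induct)
      case (insert j J)
      then have "A j \<in> R" "space M \<inter> (\<Inter>j\<in>J. A j) \<in> R" using H(2) by blast+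
      then have "A j \<inter> (space M \<inter> (\<Inter>j\<in>J. A j)) \<in> R" by (rule R.Int)
      also have "A j \<inter> (space M \<inter> (\<Inter>j\<in>J. A j)) = space M \<inter> (\<Inter>j\<in>insert j J. A j)" by auto
      finally show ?case .
    qed simp
    show "prob (space M \<inter> (\<Inter>j\<in>J. A j)) = (\<Prod>j\<in>J. prob (A j))"
    proof (cases "J = {}")
      case False
      then obtain j where "j \<in> J" by auto
      then have "A j \<subseteq> space M" using indep_sets_events[OF H(1)] J sets.sets_into_space by blast
      then have "space M \<inter> (\<Inter>j\<in>J. A j) = (\<Inter>j\<in>J. A j)" using \<open>j \<in> J\<close> by auto
      then show ?thesis using indep_setsD[OF H(1) J(2) False J(1)] J(3) by simp
    qed (simp add: prob_space)
  qed
  fix A J assume J: "J \<noteq> {}" "J \<subseteq> I <+> K" "finite J" and A: "\<forall>j\<in>J. A j \<in> case_sum F G j"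
  define J1 J2 where "J1 = Inl -` J" and "J2 = Inr -` J"
  have fin: "finite J1" "finite J2"
    using J by (auto simp: J1_def J2_def intro!: finite_vimageI)
  have split: "J = Inl ` J1 \<union> Inr ` J2"
    by (auto simp: J1_def J2_def image_iff) (metis sum.exhaust)
  have 1: "prob (space M \<inter> (\<Inter>j\<in>J1. A (Inl j))) = (\<Prod>j\<in>J1. prob (A (Inl j))) \<and> space M \<inter> (\<Inter>j\<in>J1. A (Inl j)) \<in> S"
    using F ST fin A J by (intro inter[of F I]) (auto simp: J1_def)
  have 2: "prob (space M \<inter> (\<Inter>j\<in>J2. A (Inr j))) = (\<Prod>j\<in>J2. prob (A (Inr j))) \<and> space M \<inter> (\<Inter>j\<in>J2. A (Inr j)) \<in> T"
    using G ST fin A J by (intro inter[of G K]) (auto simp: J2_def)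
  obtain j where "j \<in> J" using J by auto
  moreover have "case_sum F G j \<subseteq> events"
    using \<open>j \<in> J\<close> J(2) events by blast
  ultimately have "A j \<subseteq> space M" using A sets.sets_into_space by blast
  then have "(\<Inter>j\<in>J. A j) = (space M \<inter> (\<Inter>j\<in>J1. A (Inl j))) \<inter> (space M \<inter> (\<Inter>j\<in>J2. A (Inr j)))"
    using \<open>j \<in> J\<close> by (subst (asm) split, subst split) auto
  also have "prob \<dots> = (\<Prod>j\<in>J1. prob (A (Inl j))) * (\<Prod>j\<in>J2. prob (A (Inr j)))"
    using indep_setD[OF ST(1)] 1 2 by simp
  also have "\<dots> = (\<Prod>j\<in>J. prob (A j))"
    unfolding split using fin by (subst prod.union_disjoint) (auto simp: prod.reindex)
  finally show "prob (\<Inter>j\<in>J. A j) = (\<Prod>j\<in>J. prob (A j))" .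
qed

text \<open>\<open>X\<close> and \<open>Z\<close> take values in different types, so they are merged
  at the level of events by \<open>indep_sets_Plus\<close>. Injectivity of \<open>p\<close> and
  \<open>q\<close> makes the index groups {Inl (p l), Inr (q l)} disjoint; the sigma-algebras they
  generate are then independent, and the l-th variable is measurable with respect to the l-th
  one.\<close>

lemma indep_vars_of_pairs:
  fixes X :: "'i \<Rightarrow> 'a \<Rightarrow> 'b::topological_space" and Z :: "'k \<Rightarrow> 'a \<Rightarrow> 'c::topological_space"
  assumes X: "indep_vars (\<lambda>_. borel) X I" and Z: "indep_vars (\<lambda>_. borel) Z K"
    and XZ: "indep_set (generated_sigma M I X) (generated_sigma M K Z)"
    and p: "inj_on p L" "p ` L \<subseteq> I" and q: "inj_on q L" "q ` L \<subseteq> K"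
    and g: "\<And>l. l \<in> L \<Longrightarrow> g l \<in> borel \<Otimes>\<^sub>M borel \<rightarrow>\<^sub>M N"
  shows "indep_vars (\<lambda>_. N) (\<lambda>l \<omega>. g l (X (p l) \<omega>, Z (q l) \<omega>)) L"
proof -
  define F where "F i = {X i -` B \<inter> space M | B. B \<in> sets borel}" for i
  define G where "G k = {Z k -` B \<inter> space M | B. B \<in> sets borel}" for k
  define E where "E l = case_sum F G (Inl (p l)) \<union> case_sum F G (Inr (q l))" for l
  have FG: "indep_sets (case_sum F G) (I <+> K)"
  proof (rule indep_sets_Plus)
    show "indep_sets F I" "indep_sets G K"
      using X Z unfolding indep_vars_def2 F_def G_def by auto
    show "indep_set (generated_sigma M I X) (generated_sigma M K Z)" by fact
    show "F i \<subseteq> generated_sigma M I X" if "i \<in> I" for i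
      using that by (auto simp: F_def generated_sigma_def)
    show "G k \<subseteq> generated_sigma M K Z" if "k \<in> K" for k
      using that by (auto simp: G_def generated_sigma_def)
  qed (auto simp: generated_sigma_def intro!: sigma_algebra_sigma_sets)
  have Int_stable: "Int_stable (F i)" "Int_stable (G k)" for i k
    unfolding F_def G_def by (rule Int_stable_vimages)+
  have "indep_sets (\<lambda>l. sigma_sets (space M) (\<Union>x\<in>{Inl (p l), Inr (q l)}. case_sum F G x)) L"
  proof (rule indep_sets_collect_sigma)
    show "indep_sets (case_sum F G) (\<Union>l\<in>L. {Inl (p l), Inr (q l)})"
      by (rule indep_sets_mono_index[OF _ FG]) (use p q in auto)
    show "Int_stable (case_sum F G x)" if "x \<in> {Inl (p l), Inr (q l)}" for x l
      using that Int_stable by auto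
    show "disjoint_family_on (\<lambda>l. {Inl (p l), Inr (q l)}) L"
      using p q by (auto simp: disjoint_family_on_def inj_on_def)
  qed
  then have ind: "indep_sets (\<lambda>l. sigma_sets (space M) (E l)) L"
    by (simp add: E_def)
  have meas: "(\<lambda>\<omega>. g l (X (p l) \<omega>, Z (q l) \<omega>)) \<in> sigma (space M) (E l) \<rightarrow>\<^sub>M N" if "l \<in> L" for l
  proof (rule measurable_compose[OF _ g[OF that]], rule measurable_Pair)
    have sets: "sets (sigma (space M) (E l)) = sigma_sets (space M) (E l)"
      by (rule sets_measure_of) (auto simp: E_def F_def G_def)
    show "X (p l) \<in> borel_measurable (sigma (space M) (E l))"
    proof (rule measurableI)
      fix B :: "'b set" assume "B \<in> sets borel"
      then have "X (p l) -` B \<inter> space M \<in> E l" by (auto simp: E_def F_def)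
      then show "X (p l) -` B \<inter> space (sigma (space M) (E l)) \<in> sets (sigma (space M) (E l))"
        unfolding sets space_measure_of_conv by (rule sigma_sets.Basic)
    qed simp
    show "Z (q l) \<in> borel_measurable (sigma (space M) (E l))"
    proof (rule measurableI)
      fix B :: "'c set" assume "B \<in> sets borel"
      then have "Z (q l) -` B \<inter> space M \<in> E l" by (auto simp: E_def G_def)
      then show "Z (q l) -` B \<inter> space (sigma (space M) (E l)) \<in> sets (sigma (space M) (E l))"
        unfolding sets space_measure_of_conv by (rule sigma_sets.Basic)
    qed simp
  qed
  show ?thesis
    unfolding indep_vars_def2
  proof safe
    fix l assume l: "l \<in> L"
    have "X (p l) \<in> borel_measurable M" "Z (q l) \<in> borel_measurable M"
      using X Z p q l unfolding indep_vars_def2 by auto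
    then show "random_variable N (\<lambda>\<omega>. g l (X (p l) \<omega>, Z (q l) \<omega>))"
      by (intro measurable_compose[OF _ g[OF l]] measurable_Pair)
  next
    show "indep_sets (\<lambda>l. {(\<lambda>\<omega>. g l (X (p l) \<omega>, Z (q l) \<omega>)) -` B \<inter> space M |B. B \<in> sets N}) L"
    proof (rule indep_sets_mono_sets[OF ind], safe)
      fix l B assume "l \<in> L" "B \<in> sets N"
      from measurable_sets[OF meas[OF this(1)] this(2)]
      show "(\<lambda>\<omega>. g l (X (p l) \<omega>, Z (q l) \<omega>)) -` B \<inter> space M \<in> sigma_sets (space M) (E l)"
        by (subst (asm) sets_measure_of) (auto simp: space_measure_of_conv E_def F_def G_def)
    qed
  qed
qed

end

subsection \<open>Concentration of the privatised cell frequencies\<close>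

locale privatised_sample = prob_space M for M :: "'w measure" +
  fixes X :: "nat \<Rightarrow> 'w \<Rightarrow> real ^ 'n" and \<zeta> :: "nat \<Rightarrow> nat \<Rightarrow> 'w \<Rightarrow> real"
    and f :: "real ^ 'n \<Rightarrow> real" and s :: real
  assumes s_pos: "s > 0"
    and f_nonneg: "\<And>x. f x \<ge> 0"
    and X_distributed: "\<And>i. i \<ge> 1 \<Longrightarrow> distributed M lborel (X i) (\<lambda>x. ennreal (f x))"
    and X_indep: "indep_vars (\<lambda>_. borel) X {1..}"
    and \<zeta>_distributed: "\<And>i j. i \<ge> 1 \<Longrightarrow> j \<ge> 1 \<Longrightarrow>
      distributed M lborel (\<zeta> i j) (\<lambda>x. ennreal (laplace_density x))"
    and \<zeta>_indep: "indep_vars (\<lambda>_. borel) (\<lambda>(i, j). \<zeta> i j) ({1..} \<times> {1..})"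
    and X_\<zeta>_indep: "indep_set (generated_sigma M {1..} X)
      (generated_sigma M ({1..} \<times> {1..}) (\<lambda>(i, j). \<zeta> i j))"
begin

text \<open>By symmetry of the Laplace law this is H(1/(2s)) - H(-1/(2s)): the drop in the
  probability of falling below 1/2 when an observation lies in the cell.\<close>

definition contrast :: real where
  "contrast = 1 - 2 * laplace_cdf (- 1 / (2 * s))"

definition cell_prob :: "(real ^ 'n) set \<Rightarrow> real" where
  "cell_prob C = (LINT x:C|lborel. f x)"

text \<open>The set \<open>C\<close> and the noise column \<open>j\<close> are separate arguments,
  so mean and independence are available for any Borel set before \<open>C\<close> is taken to be
  \<open>A j\<close>.\<close>

definition response :: "(real ^ 'n) set \<Rightarrow> nat \<Rightarrow> nat \<Rightarrow> 'w \<Rightarrow> real" where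
  "response C j i \<omega> = indicator {..1/2} (indicator C (X i \<omega>) + s * \<zeta> i j \<omega>)"

lemma X_measurable: "i \<ge> 1 \<Longrightarrow> X i \<in> borel_measurable M"
  using distributed_measurable[OF X_distributed] by simp

lemma \<zeta>_measurable: "i \<ge> 1 \<Longrightarrow> j \<ge> 1 \<Longrightarrow> \<zeta> i j \<in> borel_measurable M"
  using distributed_measurable[OF \<zeta>_distributed] by simp

lemma X_event: "i \<ge> 1 \<Longrightarrow> B \<in> sets borel \<Longrightarrow> X i -` B \<inter> space M \<in> generated_sigma M {1..} X"
  unfolding generated_sigma_def by (intro sigma_sets.Basic CollectI exI conjI) auto

lemma \<zeta>_event:
  "i \<ge> 1 \<Longrightarrow> j \<ge> 1 \<Longrightarrow> B \<in> sets borel \<Longrightarrow>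
    \<zeta> i j -` B \<inter> space M \<in> generated_sigma M ({1..} \<times> {1..}) (\<lambda>(i, j). \<zeta> i j)"
  unfolding generated_sigma_def by (intro sigma_sets.Basic CollectI exI[of _ "(i, j)"] exI[of _ B]) auto

lemma f_measurable [measurable]: "f \<in> borel_measurable borel"
  using distributed_real_measurable[OF _ X_distributed[of 1]] f_nonneg by simp

lemma nn_integral_f: "(\<integral>\<^sup>+x. ennreal (f x) \<partial>lborel) = 1"
  using distributed_emeasure[OF X_distributed[of 1], of UNIV] emeasure_space_1 by simp

lemma f_integrable: "integrable lborel f"
  using f_nonneg nn_integral_f by (intro integrableI_nonneg) auto

lemma set_integrable_f: "C \<in> sets borel \<Longrightarrow> set_integrable lborel C f"
  using f_integrable unfolding set_integrable_def by (intro integrable_mult_indicator) auto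

lemma ennreal_cell_prob:
  assumes "C \<in> sets borel"
  shows "ennreal (cell_prob C) = (\<integral>\<^sup>+x. ennreal (f x) * indicator C x \<partial>lborel)"
proof -
  have "ennreal (cell_prob C) = (\<integral>\<^sup>+x. ennreal (indicator C x *\<^sub>R f x) \<partial>lborel)"
    unfolding cell_prob_def set_lebesgue_integral_def
    using set_integrable_f[OF assms] f_nonneg unfolding set_integrable_def
    by (intro nn_integral_eq_integral[symmetric]) auto
  also have "\<dots> = (\<integral>\<^sup>+x. ennreal (f x) * indicator C x \<partial>lborel)"
    by (intro nn_integral_cong) (auto simp: indicator_def)
  finally show ?thesis .
qed

lemma cell_prob_nonneg: "cell_prob C \<ge> 0"
  unfolding cell_prob_def set_lebesgue_integral_def by (intro Bochner_Integration.integral_nonneg) (simp add: f_nonneg)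

lemma prob_X:
  assumes "i \<ge> 1" "C \<in> sets borel"
  shows "prob (X i -` C \<inter> space M) = cell_prob C"
  using distributed_emeasure[OF X_distributed[OF assms(1)], of C] ennreal_cell_prob[OF assms(2), symmetric] assms(2)
    cell_prob_nonneg by (simp add: measure_def)

lemma prob_\<zeta>:
  assumes "i \<ge> 1" "j \<ge> 1"
  shows "prob (\<zeta> i j -` {..t} \<inter> space M) = laplace_cdf t"
proof -
  have "laplace_cdf t = measure (distr M lborel (\<zeta> i j)) {..t}"
    by (simp add: laplace_cdf_def cdf_def distributed_distr_eq_density[OF \<zeta>_distributed[OF assms]])
  also have "\<dots> = prob (\<zeta> i j -` {..t} \<inter> space M)"
    using \<zeta>_measurable[OF assms] by (subst measure_distr) auto
  finally show ?thesis ..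
qed

text \<open>Normalisation is read off from the law of \<open>\<zeta> 1 1\<close>, with no integral
  of the density computed.\<close>

lemma prob_space_laplace_measure: "prob_space laplace_measure"
  using prob_space_distr[of "\<zeta> 1 1" lborel] distributed_distr_eq_density[OF \<zeta>_distributed[of 1 1]]
    distributed_measurable[OF \<zeta>_distributed[of 1 1]] by simp

lemma laplace_cdf_eq_contrast: "laplace_cdf (1 / (2 * s)) = laplace_cdf (- 1 / (2 * s)) + contrast"
  using laplace_cdf_minus[OF prob_space_laplace_measure, of "1 / (2 * s)"] by (simp add: contrast_def)

lemma contrast_pos: "contrast > 0"
proof -
  have "laplace_cdf (- 1 / (2 * s)) < laplace_cdf (1 / (2 * s))"
    by (rule laplace_cdf_strict_mono[OF prob_space_laplace_measure]) (use s_pos in simp)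
  then show ?thesis by (simp add: laplace_cdf_eq_contrast)
qed

lemma response_measurable:
  assumes "C \<in> sets borel" "i \<ge> 1" "j \<ge> 1"
  shows "response C j i \<in> borel_measurable M"
proof -
  note [measurable] = assms(1) X_measurable[OF assms(2)] \<zeta>_measurable[OF assms(2,3)]
  show ?thesis unfolding response_def[abs_def] by measurable
qed

text \<open>Inside C the response is 1 iff the noise is at most -1/(2s), outside iff it is at most
  1/(2s). Independence of data and noise gives the mean H(-1/(2s)) p + H(1/(2s)) (1 - p) with p =
  \<open>cell_prob C\<close>, which is affine in p. Inverting it yields the estimator, which is
  therefore unbiased.\<close>

lemma expectation_response:
  assumes C: "C \<in> sets borel" and ij: "i \<ge> 1" "j \<ge> 1"
  shows "expectation (response C j i) = laplace_cdf (1 / (2 * s)) - contrast * cell_prob C"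
proof -
  let ?a = "X i -` C \<inter> space M" and ?a' = "X i -` (- C) \<inter> space M"
  let ?b = "\<lambda>t. \<zeta> i j -` {..t} \<inter> space M"
  let ?t = "1 / (2 * s)"
  note [measurable] = C X_measurable[OF ij(1)] \<zeta>_measurable[OF ij]
  have "response C j i \<omega> = indicator ((?a \<inter> ?b (- ?t)) \<union> (?a' \<inter> ?b ?t)) \<omega>" if "\<omega> \<in> space M" for \<omega>
    using that s_pos by (auto simp: response_def indicator_def field_simps)
  then have "expectation (response C j i) = prob ((?a \<inter> ?b (- ?t)) \<union> (?a' \<inter> ?b ?t))"
    by (subst Bochner_Integration.integral_cong[OF refl, of M _ "indicator ((?a \<inter> ?b (- ?t)) \<union> (?a' \<inter> ?b ?t))"])
      (auto simp: Int_Un_distrib2 intro!: arg_cong[where f = prob])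
  also have "\<dots> = prob (?a \<inter> ?b (- ?t)) + prob (?a' \<inter> ?b ?t)"
    by (intro finite_measure_Union) auto
  also have "prob (?a \<inter> ?b (- ?t)) = prob ?a * prob (?b (- ?t))"
    by (rule indep_setD[OF X_\<zeta>_indep]) (rule X_event[OF ij(1)] \<zeta>_event[OF ij]; use C in simp)+
  also have "prob (?a' \<inter> ?b ?t) = prob ?a' * prob (?b ?t)"
    by (rule indep_setD[OF X_\<zeta>_indep]) (rule X_event[OF ij(1)] \<zeta>_event[OF ij]; use C in simp)+
  also have "?a' = space M - ?a" by auto
  also have "prob \<dots> = 1 - prob ?a" by (rule prob_compl) measurable
  finally show ?thesis
    using prob_X[OF ij(1) C] prob_\<zeta>[OF ij] laplace_cdf_eq_contrast by (simp add: algebra_simps)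
qed

lemma indep_response:
  assumes C: "C \<in> sets borel" and j: "j \<ge> 1"
  shows "indep_vars (\<lambda>_. borel) (response C j) {1..}"
proof -
  define g :: "(real ^ 'n) \<times> real \<Rightarrow> real" where
    "g = (\<lambda>p. indicator {..1/2} (indicator C (fst p) + s * snd p))"
  have "g \<in> borel \<Otimes>\<^sub>M borel \<rightarrow>\<^sub>M borel"
    unfolding g_def using C by measurable
  \<comment> \<open>Row i is paired with the noise index (i, j); for fixed j this assignment is
    injective.\<close>
  then have "indep_vars (\<lambda>_. borel) (\<lambda>i \<omega>. g (X i \<omega>, (\<lambda>(i, j). \<zeta> i j) (i, j) \<omega>)) {1..}"
    using j by (intro indep_vars_of_pairs[OF X_indep \<zeta>_indep X_\<zeta>_indep]) (auto simp: inj_on_def)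
  then show ?thesis by (simp add: response_def[abs_def] g_def)
qed

lemma cell_estimate_eq:
  "cell_estimate A s X \<zeta> n j \<omega> =
    (laplace_cdf (1 / (2 * s)) - (1 / real n) * (\<Sum>i=1..n. response (A j) j i \<omega>)) / contrast"
  by (simp add: cell_estimate_def empirical_cdf_def privatised_def response_def contrast_def)

lemma cell_estimate_measurable:
  assumes "A j \<in> sets borel" "j \<ge> 1"
  shows "cell_estimate A s X \<zeta> n j \<in> borel_measurable M"
  unfolding cell_estimate_eq[abs_def] using response_measurable[OF assms(1) _ assms(2)] by simp

lemma cell_estimate_deviation:
  assumes A: "A j \<in> sets borel" and j: "j \<ge> 1" and n: "n \<ge> 1" and \<epsilon>: "\<epsilon> \<ge> 0"
  shows "prob {\<omega> \<in> space M. \<bar>cell_estimate A s X \<zeta> n j \<omega> - cell_prob (A j)\<bar> \<ge> \<epsilon>} \<le>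
    2 * exp (- 2 * real n * (contrast * \<epsilon>)\<^sup>2)"
proof -
  let ?\<mu> = "real n * (laplace_cdf (1 / (2 * s)) - contrast * cell_prob (A j))"
  interpret Hoeffding_ineq M "{1..n}" "response (A j) j" "\<lambda>_. 0" "\<lambda>_. 1" ?\<mu>
  proof unfold_locales
    show "indep_vars (\<lambda>_. borel) (response (A j) j) {1..n}"
      by (rule indep_vars_subset[OF indep_response[OF A j]]) auto
    show "?\<mu> \<equiv> \<Sum>i=1..n. expectation (response (A j) j i)"
      using expectation_response[OF A _ j] by (intro eq_reflection) simp
  qed (auto simp: response_def)
  \<comment> \<open>The estimation error is the centred sum of responses scaled by 1/(n
    \<open>contrast\<close>), so a deviation \<epsilon> of the estimate is a deviation n
    \<open>contrast\<close> \<epsilon> of the sum.\<close>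
  have "\<bar>cell_estimate A s X \<zeta> n j \<omega> - cell_prob (A j)\<bar> =
      \<bar>(\<Sum>i=1..n. response (A j) j i \<omega>) - ?\<mu>\<bar> / (real n * contrast)" for \<omega>
  proof -
    have "cell_estimate A s X \<zeta> n j \<omega> - cell_prob (A j) =
      - (((\<Sum>i=1..n. response (A j) j i \<omega>) - ?\<mu>) / (real n * contrast))"
      using n contrast_pos
      by (simp add: cell_estimate_eq field_simps)
    then show ?thesis using n contrast_pos by (simp add: abs_divide abs_mult)
  qed
  then have "{\<omega> \<in> space M. \<bar>cell_estimate A s X \<zeta> n j \<omega> - cell_prob (A j)\<bar> \<ge> \<epsilon>} =
     {\<omega> \<in> space M. \<bar>(\<Sum>i=1..n. response (A j) j i \<omega>) - ?\<mu>\<bar> \<ge> real n * contrast * \<epsilon>}"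
    using n contrast_pos by (simp add: pos_le_divide_eq mult_ac)
  also have "prob \<dots> \<le> 2 * exp (- 2 * (real n * contrast * \<epsilon>)\<^sup>2 / (\<Sum>i=1..n. (1 - 0)\<^sup>2))"
    using n \<epsilon> contrast_pos by (intro Hoeffding_ineq_abs_ge) auto
  also have "- 2 * (real n * contrast * \<epsilon>)\<^sup>2 / (\<Sum>i=1..n. (1 - 0)\<^sup>2) = - 2 * real n * (contrast * \<epsilon>)\<^sup>2"
    using n by (simp add: power2_eq_square field_simps)
  finally show ?thesis .
qed

end

subsection \<open>Consistency\<close>

text \<open>Borel-Cantelli for each \<epsilon>, followed by a countable intersection over \<epsilon>
  = 1/(k+1). One summable \<open>g\<close> serves all \<epsilon>, since only the index from which
  the bound holds may depend on \<epsilon>.\<close>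

lemma (in prob_space) AE_tendsto_0_if_summable_tails:
  fixes D :: "nat \<Rightarrow> 'a \<Rightarrow> real"
  assumes meas: "\<And>n. n \<ge> 1 \<Longrightarrow> D n \<in> borel_measurable M"
    and sumb: "summable g"
    and bound: "\<And>\<epsilon>. \<epsilon> > 0 \<Longrightarrow> eventually (\<lambda>n. prob {\<omega> \<in> space M. \<bar>D n \<omega>\<bar> \<ge> \<epsilon>} \<le> g n) sequentially"
  shows "AE \<omega> in M. (\<lambda>n. D n \<omega>) \<longlonglongrightarrow> 0"
proof -
  have "AE \<omega> in M. eventually (\<lambda>n. \<bar>D n \<omega>\<bar> < \<epsilon>) sequentially" if "\<epsilon> > 0" for \<epsilon>
  proof -
    \<comment> \<open>The guard n \<ge> 1 makes \<open>B 0\<close> empty, hence measurable: nothing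
      is assumed about \<open>D 0\<close>.\<close>
    define B where "B n = {\<omega> \<in> space M. n \<ge> 1 \<and> \<bar>D n \<omega>\<bar> \<ge> \<epsilon>}" for n
    have "B n \<in> sets M" for n
    proof (cases "n \<ge> 1")
      case True
      note [measurable] = meas[OF True]
      show ?thesis unfolding B_def by measurable
    qed (simp add: B_def)
    moreover have "summable (\<lambda>n. prob (B n))"
    proof (rule summable_comparison_test_ev[OF _ sumb])
      show "eventually (\<lambda>n. norm (prob (B n)) \<le> g n) sequentially"
        using bound[OF that] eventually_ge_at_top[of 1]
        by eventually_elim (simp add: B_def)
    qed
    ultimately have "AE \<omega> in M. eventually (\<lambda>n. \<omega> \<in> space M - B n) sequentially"
      by (intro borel_cantelli_AE1) (auto simp: emeasure_eq_measure)
    then show ?thesis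
    proof eventually_elim
      case (elim \<omega>)
      then show ?case
        using eventually_ge_at_top[of 1] by eventually_elim (auto simp: B_def)
    qed
  qed
  then have "AE \<omega> in M. \<forall>k. eventually (\<lambda>n. \<bar>D n \<omega>\<bar> < inverse (real (Suc k))) sequentially"
    by (subst AE_all_countable) simp
  then show ?thesis
  proof eventually_elim
    case (elim \<omega>)
    show ?case
    proof (rule tendstoI)
      fix e :: real assume "e > 0"
      then obtain k where "inverse (real (Suc k)) < e" using reals_Archimedean by blast
      then show "eventually (\<lambda>n. dist (D n \<omega>) 0 < e) sequentially"
        using elim[THEN spec, of k] by (auto elim!: eventually_mono)
    qed
  qed
qed

text \<open>Turns an exponent of order ln n into a power of n: k = 2 serves a single cell, k = 3 the
  union bound over all cells.\<close>

lemma exp_minus_mult_ln: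
  assumes "n \<ge> 1" "real k * ln (real n) \<le> t"
  shows "exp (- t) \<le> 1 / real n ^ k"
proof -
  have "exp (- t) \<le> exp (- (real k * ln (real n)))" using assms by simp
  also have "\<dots> = 1 / real n ^ k"
    using assms by (simp add: exp_minus exp_of_nat_mult divide_inverse)
  finally show ?thesis .
qed

lemma summable_inverse_square: "summable (\<lambda>n. 2 * (1 / real n ^ 2))"
  using inverse_power_summable[of 2, where ?'a = real]
  by (intro summable_mult) (simp add: inverse_eq_divide)

text \<open>The conditions of (i) only; the stronger condition of (ii) enters later as the explicit
  assumption \<open>wide\<close>.\<close>

locale privatised_histogram = privatised_sample M X \<zeta> f s
  for M :: "'w measure" and X :: "nat \<Rightarrow> 'w \<Rightarrow> real ^ 'n" and \<zeta> f s +
  fixes h r :: "nat \<Rightarrow> real" and A :: "nat \<Rightarrow> nat \<Rightarrow> (real ^ 'n) set" and N :: "nat \<Rightarrow> nat"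
  assumes h_pos: "\<And>n. n \<ge> 1 \<Longrightarrow> h n > 0"
    and r_pos: "\<And>n. n \<ge> 1 \<Longrightarrow> r n > 0"
    and partition: "\<And>n. n \<ge> 1 \<Longrightarrow> cubic_partition (h n) (A n)"
    and retained: "\<And>n j. n \<ge> 1 \<Longrightarrow> j \<ge> 1 \<Longrightarrow> A n j \<inter> cball 0 (r n) \<noteq> {} \<longleftrightarrow> j \<le> N n"
    and r_lim: "filterlim r at_top sequentially"
    and h_lim: "h \<longlonglongrightarrow> 0"
    and bandwidth: "filterlim (\<lambda>n. real n * h n ^ (2 * CARD('n)) / ln (real n)) at_top sequentially"
begin

abbreviation "estimate n j \<omega> \<equiv> cell_estimate (A n) s X \<zeta> n j \<omega>"

text \<open>For n \<ge> 1 this is the expectation of the private histogram, as the cell estimates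
  are unbiased. It separates the bias \<open>mean_histogram n x - f x\<close> from the stochastic
  error.\<close>

definition mean_histogram :: "nat \<Rightarrow> real ^ 'n \<Rightarrow> real" where
  "mean_histogram n x = (\<Sum>j=1..N n. cell_prob (A n j) / h n ^ CARD('n) * indicator (A n j) x)"

lemma cell_sets: "n \<ge> 1 \<Longrightarrow> j \<ge> 1 \<Longrightarrow> A n j \<in> sets borel"
  using is_cube_sets_borel[OF cubic_partition_cell[OF partition]] .

section \<open>Pointwise convergence\<close>

lemma eventually_cell_index_le: "eventually (\<lambda>n. cell_index (A n) x \<le> N n) sequentially"
proof -
  have "eventually (\<lambda>n. norm x \<le> r n) sequentially"
    using r_lim by (simp add: filterlim_at_top)
  then show ?thesis
    using eventually_ge_at_top[of 1]
  proof eventually_elim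
    case (elim n)
    then have "x \<in> A n (cell_index (A n) x) \<inter> cball 0 (r n)"
      using cell_index(2)[OF partition[of n]] by simp
    then show ?case
      using retained[of n "cell_index (A n) x"] cell_index(1)[OF partition[of n], of x] elim by blast
  qed
qed

text \<open>For fixed x only one cell per n matters, so no union bound is involved. A deviation
  \<epsilon> of the density estimate is a deviation \<epsilon> \<open>h^d\<close> of the cell
  estimate, which puts n \<open>h^(2d)\<close> into the Hoeffding exponent.\<close>

lemma estimate_at_point_tendsto:
  "AE \<omega> in M. (\<lambda>n. (estimate n (cell_index (A n) x) \<omega> - cell_prob (A n (cell_index (A n) x))) / h n ^ CARD('n)) \<longlonglongrightarrow> 0"
proof (rule AE_tendsto_0_if_summable_tails[OF _ summable_inverse_square])
  fix n :: nat assume n: "n \<ge> 1"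
  have "cell_estimate (A n) s X \<zeta> n (cell_index (A n) x) \<in> borel_measurable M"
    by (intro cell_estimate_measurable cell_sets n cell_index(1)[OF partition])
  then show "(\<lambda>\<omega>. (estimate n (cell_index (A n) x) \<omega> - cell_prob (A n (cell_index (A n) x))) / h n ^ CARD('n)) \<in> borel_measurable M"
    by measurable
next
  fix \<epsilon> :: real assume "\<epsilon> > 0"
  \<comment> \<open>With this constant the Hoeffding exponent is at least 2 ln n, so the tail is at
    most 2/n^2.\<close>
  have "eventually (\<lambda>n. 1 / (contrast * \<epsilon>)\<^sup>2 \<le> real n * h n ^ (2 * CARD('n)) / ln (real n)) sequentially"
    using bandwidth unfolding filterlim_at_top by blast
  then show "eventually (\<lambda>n. prob {\<omega> \<in> space M. \<bar>(estimate n (cell_index (A n) x) \<omega> -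
      cell_prob (A n (cell_index (A n) x))) / h n ^ CARD('n)\<bar> \<ge> \<epsilon>} \<le> 2 * (1 / real n ^ 2)) sequentially"
    using eventually_ge_at_top[of 2]
  proof eventually_elim
    case (elim n)
    let ?j = "cell_index (A n) x"
    have h: "h n ^ CARD('n) > 0" using h_pos elim by simp
    have j: "?j \<ge> 1" using cell_index(1)[OF partition] elim by simp
    have "ln (real n) > 0" using elim by simp
    then have "ln (real n) \<le> (contrast * \<epsilon>)\<^sup>2 * (real n * h n ^ (2 * CARD('n)))"
    proof -
      define q where "q = (contrast * \<epsilon>)\<^sup>2"
      have "q > 0" using contrast_pos \<open>\<epsilon> > 0\<close> by (simp add: q_def)
      then show ?thesis
        using elim(1) \<open>ln (real n) > 0\<close> unfolding q_def[symmetric] by (simp add: field_simps)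
    qed
    also have "\<dots> = real n * (contrast * (\<epsilon> * h n ^ CARD('n)))\<^sup>2"
      by (simp only: power_even_eq power_mult_distrib) (simp only: mult_ac)
    finally have "exp (- (2 * real n * (contrast * (\<epsilon> * h n ^ CARD('n)))\<^sup>2)) \<le> 1 / real n ^ 2"
      using elim by (intro exp_minus_mult_ln) auto
    moreover have "prob {\<omega> \<in> space M. \<bar>estimate n ?j \<omega> - cell_prob (A n ?j)\<bar> \<ge> \<epsilon> * h n ^ CARD('n)} \<le>
        2 * exp (- 2 * real n * (contrast * (\<epsilon> * h n ^ CARD('n)))\<^sup>2)"
      using elim h \<open>\<epsilon> > 0\<close> j by (intro cell_estimate_deviation cell_sets) auto
    moreover have "{\<omega> \<in> space M. \<bar>(estimate n ?j \<omega> - cell_prob (A n ?j)) / h n ^ CARD('n)\<bar> \<ge> \<epsilon>} =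
        {\<omega> \<in> space M. \<bar>estimate n ?j \<omega> - cell_prob (A n ?j)\<bar> \<ge> \<epsilon> * h n ^ CARD('n)}"
      using h by (simp add: abs_divide field_simps)
    ultimately show ?case by simp
  qed
qed

text \<open>Once the cell of x is retained, the bias is the average of f z - f x over that cell. It
  is at most the integral of |f z - f x| over the centred cube of side 2h divided by
  \<open>h^d\<close>, which vanishes at Lebesgue points.\<close>

lemma mean_histogram_tendsto: "AE x in lborel. (\<lambda>n. mean_histogram n x) \<longlonglongrightarrow> f x"
  using AE_lebesgue_point[OF f_integrable]
proof eventually_elim
  case (elim x)
  let ?box = "\<lambda>t. cbox (x - t *\<^sub>R One) (x + t *\<^sub>R One)"
  have "eventually (\<lambda>n. h n > 0) sequentially"
    using eventually_ge_at_top[of 1] by eventually_elim (rule h_pos)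
  then have "filterlim h (at_right 0) sequentially"
    using h_lim by (intro filterlim_at_withinI) (auto elim!: eventually_mono)
  from filterlim_compose[OF elim this]
  have lim: "(\<lambda>n. (LINT z:?box (h n)|lborel. \<bar>f z - f x\<bar>) / h n ^ CARD('n)) \<longlonglongrightarrow> 0"
    by simp
  have "(\<lambda>n. mean_histogram n x - f x) \<longlonglongrightarrow> 0"
  proof (rule Lim_null_comparison[OF _ lim])
    show "eventually (\<lambda>n. norm (mean_histogram n x - f x) \<le>
        (LINT z:?box (h n)|lborel. \<bar>f z - f x\<bar>) / h n ^ CARD('n)) sequentially"
      using eventually_cell_index_le[of x] eventually_ge_at_top[of 1]
    proof eventually_elim
      case (elim n)
      let ?j = "cell_index (A n) x"
      define C where "C = A n ?j"
      note part = partition[OF elim(2)]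
      have h: "h n > 0" using h_pos elim by simp
      have cube: "is_cube (h n) C"
        unfolding C_def using cubic_partition_cell[OF part] cell_index(1)[OF part] .
      have [measurable]: "C \<in> sets borel" using is_cube_sets_borel[OF cube] .
      have "C \<subseteq> ?box (h n)"
        using is_cube_subset_cbox[OF cube] cell_index(2)[OF part, of x] by (simp add: C_def)
      have int1: "set_integrable lborel S (\<lambda>_. f x)" if "S \<in> sets borel" "emeasure lborel S < \<infinity>" for S :: "(real ^ 'n) set"
        using that unfolding set_integrable_def
        by (intro integrable_scaleR_left) (auto simp: integrable_indicator_iff)
      have "emeasure lborel C < \<infinity>"
        using emeasure_is_cube[OF cube h] by simp
      then have intC: "set_integrable lborel C (\<lambda>z. f z - f x)"
        by (intro set_integral_diff set_integrable_f int1) auto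
      have intB: "set_integrable lborel (?box (h n)) (\<lambda>z. \<bar>f z - f x\<bar>)"
        by (intro set_integrable_abs set_integral_diff set_integrable_f int1)
          (use emeasure_lborel_cbox_finite[of "x - h n *\<^sub>R One" "x + h n *\<^sub>R One"] in auto)
      have "mean_histogram n x = cell_prob C / h n ^ CARD('n)"
        unfolding mean_histogram_def sum_indicator_cells[OF part] C_def using elim by simp
      moreover have "(LINT z:C|lborel. f z - f x) = cell_prob C - h n ^ CARD('n) * f x"
      proof -
        have "(LINT z:C|lborel. f z - f x) = (LINT z:C|lborel. f z) - (LINT z:C|lborel. f x)"
          by (intro set_integral_diff set_integrable_f int1) (use \<open>emeasure lborel C < \<infinity>\<close> in auto)
        then show ?thesis
          by (simp add: cell_prob_def set_lebesgue_integral_def measure_is_cube[OF cube h])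
      qed
      ultimately have "mean_histogram n x - f x = (LINT z:C|lborel. f z - f x) / h n ^ CARD('n)"
        using h by (simp add: diff_divide_distrib)
      moreover have "\<bar>LINT z:C|lborel. f z - f x\<bar> \<le> (LINT z:C|lborel. \<bar>f z - f x\<bar>)"
        using set_integral_norm_bound[OF intC] by simp
      moreover have "(LINT z:C|lborel. \<bar>f z - f x\<bar>) \<le> (LINT z:?box (h n)|lborel. \<bar>f z - f x\<bar>)"
        using intB set_integrable_subset[OF intB _ \<open>C \<subseteq> ?box (h n)\<close>] \<open>C \<subseteq> ?box (h n)\<close>
        unfolding set_lebesgue_integral_def set_integrable_def
        by (intro integral_mono) (auto simp: indicator_def)
      ultimately show ?case
        using h by (simp add: abs_divide divide_right_mono)
    qed
  qed
  then show ?case by (simp add: LIM_zero_iff)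
qed

text \<open>Sum of stochastic error and bias. The exceptional \<omega> may depend on x, and the
  decomposition holds once the cell of x is retained.\<close>

lemma private_histogram_tendsto:
  "AE x in lborel. AE \<omega> in M. (\<lambda>n. private_histogram (A n) (N n) (h n) s X \<zeta> n x \<omega>) \<longlonglongrightarrow> f x"
  using mean_histogram_tendsto
proof eventually_elim
  case mean: (elim x)
  have "eventually (\<lambda>n. \<forall>\<omega>. private_histogram (A n) (N n) (h n) s X \<zeta> n x \<omega> =
      (estimate n (cell_index (A n) x) \<omega> - cell_prob (A n (cell_index (A n) x))) / h n ^ CARD('n) + mean_histogram n x) sequentially"
    using eventually_cell_index_le[of x] eventually_ge_at_top[of 1]
  proof eventually_elim
    case (elim n)
    then show ?case
      unfolding mean_histogram_def sum_indicator_cells[OF partition[OF elim(2)]]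
      by (simp add: private_histogram_def diff_divide_distrib)
  qed
  note eq = this
  show ?case
    using estimate_at_point_tendsto[of x]
  proof eventually_elim
    case (elim \<omega>)
    have "(\<lambda>n. (estimate n (cell_index (A n) x) \<omega> - cell_prob (A n (cell_index (A n) x))) / h n ^ CARD('n) +
        mean_histogram n x) \<longlonglongrightarrow> f x"
      using tendsto_add[OF elim mean] by simp
    then show ?case
      by (rule Lim_transform_eventually) (use eq in \<open>auto elim!: eventually_mono\<close>)
  qed
qed

section \<open>Convergence of the bias in L1\<close>

lemma mean_histogram_measurable [measurable]:
  "n \<ge> 1 \<Longrightarrow> mean_histogram n \<in> borel_measurable borel"
  unfolding mean_histogram_def[abs_def] using cell_sets by (intro borel_measurable_sum) auto

lemma mean_histogram_nonneg: "n \<ge> 1 \<Longrightarrow> mean_histogram n x \<ge> 0"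
  unfolding mean_histogram_def using cell_prob_nonneg h_pos
  by (intro sum_nonneg mult_nonneg_nonneg divide_nonneg_nonneg) (auto simp: less_imp_le)

text \<open>The volume of each cell cancels the normalisation. Used with cell probabilities for the
  total mass of \<open>mean_histogram\<close>, and with absolute deviations for the stochastic error
  in L1.\<close>

lemma nn_integral_cells:
  assumes n: "n \<ge> 1" and a: "\<And>j. a j \<ge> 0"
  shows "(\<integral>\<^sup>+x. ennreal (\<Sum>j=1..N n. a j / h n ^ CARD('n) * indicator (A n j) x) \<partial>lborel) =
    ennreal (\<Sum>j=1..N n. a j)"
proof -
  have h: "h n > 0" using h_pos n .
  have m[measurable]: "A n j \<in> sets borel" if "j \<in> {1..N n}" for j
    using cell_sets n that by simp
  have "(\<integral>\<^sup>+x. ennreal (\<Sum>j=1..N n. a j / h n ^ CARD('n) * indicator (A n j) x) \<partial>lborel) =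
    (\<integral>\<^sup>+x. (\<Sum>j=1..N n. ennreal (a j / h n ^ CARD('n)) * indicator (A n j) x) \<partial>lborel)"
  proof (rule nn_integral_cong)
    fix x
    have "(\<Sum>j=1..N n. ennreal (a j / h n ^ CARD('n)) * indicator (A n j) x) =
        (\<Sum>j=1..N n. ennreal (a j / h n ^ CARD('n) * indicator (A n j) x))"
      by (rule sum.cong) (auto simp: indicator_def)
    also have "\<dots> = ennreal (\<Sum>j=1..N n. a j / h n ^ CARD('n) * indicator (A n j) x)"
      using a h by (intro sum_ennreal) simp
    finally show "ennreal (\<Sum>j=1..N n. a j / h n ^ CARD('n) * indicator (A n j) x) =
        (\<Sum>j=1..N n. ennreal (a j / h n ^ CARD('n)) * indicator (A n j) x)" ..
  qed
  also have "\<dots> = (\<Sum>j=1..N n. \<integral>\<^sup>+x. ennreal (a j / h n ^ CARD('n)) * indicator (A n j) x \<partial>lborel)"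
    using m by (intro nn_integral_sum) auto
  also have "\<dots> = (\<Sum>j=1..N n. ennreal (a j))"
  proof (rule sum.cong[OF refl])
    fix j assume j: "j \<in> {1..N n}"
    have "(\<integral>\<^sup>+x. ennreal (a j / h n ^ CARD('n)) * indicator (A n j) x \<partial>lborel) =
        ennreal (a j / h n ^ CARD('n)) * ennreal (h n ^ CARD('n))"
      using m[OF j] j emeasure_is_cube[OF cubic_partition_cell[OF partition[OF n]] h, of j]
      by (simp add: nn_integral_cmult_indicator)
    then show "(\<integral>\<^sup>+x. ennreal (a j / h n ^ CARD('n)) * indicator (A n j) x \<partial>lborel) = ennreal (a j)"
      using h a by (simp add: ennreal_mult[symmetric])
  qed
  finally show ?thesis using a by simp
qed

lemma sum_cell_prob_le_1:
  assumes n: "n \<ge> 1"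
  shows "(\<Sum>j=1..N n. cell_prob (A n j)) \<le> 1"
proof -
  have m[measurable]: "A n j \<in> sets borel" if "j \<in> {1..N n}" for j
    using cell_sets n that by simp
  have "ennreal (\<Sum>j=1..N n. cell_prob (A n j)) = (\<Sum>j=1..N n. ennreal (cell_prob (A n j)))"
    using cell_prob_nonneg by simp
  also have "\<dots> = (\<Sum>j=1..N n. \<integral>\<^sup>+x. ennreal (f x) * indicator (A n j) x \<partial>lborel)"
    using m by (intro sum.cong ennreal_cell_prob) auto
  also have "\<dots> = (\<integral>\<^sup>+x. (\<Sum>j=1..N n. ennreal (f x) * indicator (A n j) x) \<partial>lborel)"
    using m by (intro nn_integral_sum[symmetric]) auto
  also have "\<dots> \<le> (\<integral>\<^sup>+x. ennreal (f x) \<partial>lborel)"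
  proof (rule nn_integral_mono)
    fix x
    have "(\<Sum>j=1..N n. ennreal (f x) * indicator (A n j) x) = ennreal (\<Sum>j=1..N n. f x * indicator (A n j) x)"
      using f_nonneg by (subst sum_ennreal[symmetric]) (auto simp: ennreal_mult ennreal_indicator)
    also have "\<dots> \<le> ennreal (f x)"
      unfolding sum_indicator_cells[OF partition[OF n]] using f_nonneg by (intro ennreal_leI) auto
    finally show "(\<Sum>j=1..N n. ennreal (f x) * indicator (A n j) x) \<le> ennreal (f x)" .
  qed
  finally have "ennreal (\<Sum>j=1..N n. cell_prob (A n j)) \<le> ennreal 1"
    by (simp add: nn_integral_f)
  then show ?thesis by (subst (asm) ennreal_le_iff) auto
qed

text \<open>Scheffe: almost everywhere convergence, together with mass at most 1, the integral of f.
  The shift to \<open>Suc n\<close> avoids index 0, about which nothing is assumed.\<close>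

lemma mean_histogram_L1:
  "(\<lambda>n. \<integral>\<^sup>+x. ennreal \<bar>mean_histogram n x - f x\<bar> \<partial>lborel) \<longlonglongrightarrow> 0"
proof -
  have "(\<lambda>n. \<integral>\<^sup>+x. norm (mean_histogram (Suc n) x - f x) \<partial>lborel) \<longlonglongrightarrow> 0"
  proof (rule Scheffe_lemma2)
    show "mean_histogram (Suc n) \<in> borel_measurable lborel" for n by simp
    show "AE x in lborel. (\<lambda>n. mean_histogram (Suc n) x) \<longlonglongrightarrow> f x"
      using mean_histogram_tendsto by eventually_elim (rule LIMSEQ_Suc)
    show "(\<integral>\<^sup>+x. norm (mean_histogram (Suc n) x) \<partial>lborel) \<le> (\<integral>\<^sup>+x. norm (f x) \<partial>lborel)" for n
    proof -
      have "(\<integral>\<^sup>+x. norm (mean_histogram (Suc n) x) \<partial>lborel) = (\<integral>\<^sup>+x. ennreal (mean_histogram (Suc n) x) \<partial>lborel)"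
        by (simp add: mean_histogram_nonneg)
      also have "\<dots> = ennreal (\<Sum>j=1..N (Suc n). cell_prob (A (Suc n) j))"
        unfolding mean_histogram_def by (rule nn_integral_cells) (auto intro: cell_prob_nonneg)
      also have "\<dots> \<le> ennreal 1"
        by (intro ennreal_leI sum_cell_prob_le_1) simp
      finally show ?thesis using nn_integral_f f_nonneg by simp
    qed
  qed (rule f_integrable)
  then show ?thesis
    by (intro LIMSEQ_imp_Suc[of "\<lambda>n. \<integral>\<^sup>+x. ennreal \<bar>mean_histogram n x - f x\<bar> \<partial>lborel"]) simp
qed

section \<open>Stochastic error in L1\<close>

text \<open>For n \<ge> 1 this equals the L1 distance between the private histogram and
  \<open>mean_histogram\<close>, by \<open>nn_integral_cells\<close>.\<close>

definition total_deviation :: "nat \<Rightarrow> 'w \<Rightarrow> real" where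
  "total_deviation n \<omega> = (\<Sum>j=1..N n. \<bar>estimate n j \<omega> - cell_prob (A n j)\<bar>)"

text \<open>If the sum reaches \<epsilon>, some of its \<open>N n\<close> terms reaches
  \<epsilon>/\<open>N n\<close>; the union bound and Hoeffding do the rest. For
  \<open>N n = 0\<close> the event is empty and the right-hand side is 0.\<close>

lemma total_deviation_bound:
  assumes n: "n \<ge> 1" and \<epsilon>: "\<epsilon> > 0"
  shows "prob {\<omega> \<in> space M. total_deviation n \<omega> \<ge> \<epsilon>} \<le>
    real (N n) * (2 * exp (- 2 * real n * (contrast * (\<epsilon> / real (N n)))\<^sup>2))"
proof -
  let ?B = "\<lambda>j. {\<omega> \<in> space M. \<bar>estimate n j \<omega> - cell_prob (A n j)\<bar> \<ge> \<epsilon> / real (N n)}"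
  have B: "?B j \<in> sets M" if "j \<in> {1..N n}" for j
  proof -
    have [measurable]: "cell_estimate (A n) s X \<zeta> n j \<in> borel_measurable M"
      using that by (intro cell_estimate_measurable cell_sets n) auto
    show ?thesis by measurable
  qed
  have "{\<omega> \<in> space M. total_deviation n \<omega> \<ge> \<epsilon>} \<subseteq> (\<Union>j\<in>{1..N n}. ?B j)"
  proof safe
    fix \<omega> assume \<omega>: "\<omega> \<in> space M" "\<epsilon> \<le> total_deviation n \<omega>"
    show "\<omega> \<in> (\<Union>j\<in>{1..N n}. ?B j)"
    proof (rule ccontr)
      assume "\<omega> \<notin> (\<Union>j\<in>{1..N n}. ?B j)"
      then have small: "\<bar>estimate n j \<omega> - cell_prob (A n j)\<bar> < \<epsilon> / real (N n)" if "j \<in> {1..N n}" for j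
        using that \<omega> by (auto simp: not_le)
      have "N n \<noteq> 0"
      proof
        assume "N n = 0"
        then have "total_deviation n \<omega> = 0" unfolding total_deviation_def by simp
        then show False using \<omega>(2) \<epsilon> by simp
      qed
      then have "total_deviation n \<omega> < (\<Sum>j=1..N n. \<epsilon> / real (N n))"
        unfolding total_deviation_def using small by (intro sum_strict_mono) auto
      then show False using \<omega>(2) \<open>N n \<noteq> 0\<close> by simp
    qed
  qed
  then have "prob {\<omega> \<in> space M. total_deviation n \<omega> \<ge> \<epsilon>} \<le> prob (\<Union>j\<in>{1..N n}. ?B j)"
    using B by (intro finite_measure_mono) auto
  also have "\<dots> \<le> (\<Sum>j=1..N n. prob (?B j))"
    using B by (intro finite_measure_subadditive_finite) auto
  also have "\<dots> \<le> (\<Sum>j=1..N n. 2 * exp (- 2 * real n * (contrast * (\<epsilon> / real (N n)))\<^sup>2))"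
    using \<epsilon> by (intro sum_mono cell_estimate_deviation cell_sets n) auto
  finally show ?thesis by simp
qed

text \<open>Once h < 1 \<le> r, the volume count gives \<open>N\<close> \<le> (4r/h)^d. Squaring
  produces the ratio \<open>r^(2d)\<close>/\<open>h^(2d)\<close> of the assumption, and the factor
  \<open>4^(2d)\<close> is absorbed because that assumption beats every constant.\<close>

lemma eventually_number_of_cells:
  assumes wide: "filterlim (\<lambda>n. real n * h n ^ (2 * CARD('n)) / (r n ^ (2 * CARD('n)) * ln (real n)))
      at_top sequentially"
    and K: "K > 0"
  shows "eventually (\<lambda>n. K * (real (N n))\<^sup>2 * ln (real n) \<le> real n) sequentially"
proof -
  let ?d = "CARD('n)"
  have "eventually (\<lambda>n. K * 4 ^ (2 * ?d) \<le> real n * h n ^ (2 * ?d) / (r n ^ (2 * ?d) * ln (real n))) sequentially"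
    using wide unfolding filterlim_at_top by blast
  moreover have "eventually (\<lambda>n. h n < 1) sequentially"
    using order_tendstoD(2)[OF h_lim, of 1] by simp
  moreover have "eventually (\<lambda>n. 1 \<le> r n) sequentially"
    using r_lim by (simp add: filterlim_at_top)
  ultimately show ?thesis
    using eventually_ge_at_top[of 2]
  proof eventually_elim
    case (elim n)
    have n: "n \<ge> 1" using elim by simp
    have h: "h n > 0" using h_pos[OF n] .
    have ln: "ln (real n) > 0" using elim by simp
    have "real (N n) * h n ^ ?d \<le> (2 * (r n + h n)) ^ ?d"
      by (rule number_of_cells_le[OF partition[OF n] h]) (use r_pos[OF n] retained[OF n] in auto)
    also have "\<dots> \<le> (4 * r n) ^ ?d"
      using elim h by (intro power_mono) auto
    finally have "(real (N n) * h n ^ ?d)\<^sup>2 \<le> ((4 * r n) ^ ?d)\<^sup>2"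
      using h by (intro power_mono) auto
    then have "(real (N n))\<^sup>2 * h n ^ (2 * ?d) \<le> 4 ^ (2 * ?d) * r n ^ (2 * ?d)"
      by (simp add: power_mult_distrib power_mult[symmetric] mult.commute[of 2])
    then have "K * ln (real n) * ((real (N n))\<^sup>2 * h n ^ (2 * ?d)) \<le> K * ln (real n) * (4 ^ (2 * ?d) * r n ^ (2 * ?d))"
      using K ln by (intro mult_left_mono) auto
    also have "\<dots> = K * 4 ^ (2 * ?d) * (r n ^ (2 * ?d) * ln (real n))"
      by simp
    also have "\<dots> \<le> real n * h n ^ (2 * ?d)"
      using elim(1) r_pos[OF n] ln by (simp add: pos_le_divide_eq)
    finally have "(K * (real (N n))\<^sup>2 * ln (real n)) * h n ^ (2 * ?d) \<le> real n * h n ^ (2 * ?d)"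
      by (simp add: mult_ac)
    then show ?case
      using h by simp
  qed
qed

lemma total_deviation_tendsto:
  assumes wide: "filterlim (\<lambda>n. real n * h n ^ (2 * CARD('n)) / (r n ^ (2 * CARD('n)) * ln (real n)))
      at_top sequentially"
  shows "AE \<omega> in M. (\<lambda>n. total_deviation n \<omega>) \<longlonglongrightarrow> 0"
proof (rule AE_tendsto_0_if_summable_tails[OF _ summable_inverse_square])
  fix n :: nat assume n: "n \<ge> 1"
  have "cell_estimate (A n) s X \<zeta> n j \<in> borel_measurable M" if "j \<in> {1..N n}" for j
    using that by (intro cell_estimate_measurable cell_sets n) auto
  then show "total_deviation n \<in> borel_measurable M"
    unfolding total_deviation_def[abs_def]
    by (intro borel_measurable_sum borel_measurable_abs borel_measurable_diff borel_measurable_const)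
next
  fix \<epsilon> :: real assume \<epsilon>: "\<epsilon> > 0"
  \<comment> \<open>The constant 1 serves to bound the number of terms in the union bound by
    n.\<close>
  have "eventually (\<lambda>n. 1 * (real (N n))\<^sup>2 * ln (real n) \<le> real n) sequentially"
    by (rule eventually_number_of_cells[OF wide]) simp
  \<comment> \<open>This constant makes the Hoeffding exponent at least 3 ln n, so at most n cells
    contribute 2/n^3 each.\<close>
  moreover have "eventually (\<lambda>n. (3 / (2 * (contrast * \<epsilon>)\<^sup>2)) * (real (N n))\<^sup>2 * ln (real n) \<le> real n) sequentially"
    by (rule eventually_number_of_cells[OF wide]) (use contrast_pos \<epsilon> in simp)
  ultimately show "eventually (\<lambda>n. prob {\<omega> \<in> space M. \<bar>total_deviation n \<omega>\<bar> \<ge> \<epsilon>} \<le> 2 * (1 / real n ^ 2)) sequentially"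
    using eventually_ge_at_top[of 3]
  proof eventually_elim
    case (elim n)
    have n: "n \<ge> 1" using elim by simp
    have nonneg: "\<bar>total_deviation n \<omega>\<bar> = total_deviation n \<omega>" for \<omega>
      by (simp add: total_deviation_def sum_nonneg)
    have bound: "prob {\<omega> \<in> space M. \<bar>total_deviation n \<omega>\<bar> \<ge> \<epsilon>} \<le>
        real (N n) * (2 * exp (- 2 * real n * (contrast * (\<epsilon> / real (N n)))\<^sup>2))"
      unfolding nonneg by (rule total_deviation_bound[OF n \<epsilon>])
    show ?case
    proof (cases "N n = 0")
      case True
      then have "real (N n) * (2 * exp (- 2 * real n * (contrast * (\<epsilon> / real (N n)))\<^sup>2)) \<le> 2 * (1 / real n ^ 2)"
        by simp
      then show ?thesis using bound by linarith
    next
      case False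
      \<comment> \<open>n \<ge> 3 ensures ln n \<ge> 1, and then \<open>N\<close> \<le>
        \<open>N^2\<close> \<le> \<open>N^2\<close> ln n \<le> n.\<close>
      have "exp (1::real) \<le> real n" using exp_le elim(3) by linarith
      then have "1 \<le> ln (real n)" using elim(3) by (subst ln_ge_iff) auto
      then have "(real (N n))\<^sup>2 * 1 \<le> (real (N n))\<^sup>2 * ln (real n)"
        by (intro mult_left_mono) auto
      moreover have "real (N n) * 1 \<le> (real (N n))\<^sup>2"
        unfolding power2_eq_square using False by (intro mult_left_mono) auto
      ultimately have Nn: "real (N n) \<le> real n"
        using elim(1) unfolding mult_1_left mult_1_right by linarith
      have "3 * ln (real n) \<le> 2 * real n * (contrast * (\<epsilon> / real (N n)))\<^sup>2"
        using elim(2) False contrast_pos \<epsilon> by (simp add: field_simps power2_eq_square)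
      then have "exp (- (2 * real n * (contrast * (\<epsilon> / real (N n)))\<^sup>2)) \<le> 1 / real n ^ 3"
        using n by (intro exp_minus_mult_ln) auto
      then have "real (N n) * (2 * exp (- 2 * real n * (contrast * (\<epsilon> / real (N n)))\<^sup>2)) \<le>
          real n * (2 * (1 / real n ^ 3))"
        using Nn by (intro mult_mono) auto
      also have "\<dots> = 2 * (1 / real n ^ 2)"
        using n by (simp add: power2_eq_square power3_eq_cube)
      finally show ?thesis using bound by linarith
    qed
  qed
qed

text \<open>Triangle inequality through \<open>mean_histogram\<close>: the first distance is
  \<open>total_deviation\<close>, the second is the bias. Fixing one \<omega> with
  \<open>total_deviation\<close> tending to 0 suffices, as the bias is deterministic.\<close>

lemma private_histogram_L1:
  assumes wide: "filterlim (\<lambda>n. real n * h n ^ (2 * CARD('n)) / (r n ^ (2 * CARD('n)) * ln (real n)))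
      at_top sequentially"
  shows "AE \<omega> in M. (\<lambda>n. \<integral>\<^sup>+x. ennreal \<bar>private_histogram (A n) (N n) (h n) s X \<zeta> n x \<omega> - f x\<bar> \<partial>lborel) \<longlonglongrightarrow> 0"
  using total_deviation_tendsto[OF wide]
proof eventually_elim
  case (elim \<omega>)
  let ?T = "\<lambda>n. \<integral>\<^sup>+x. ennreal \<bar>mean_histogram n x - f x\<bar> \<partial>lborel"
  have lim: "(\<lambda>n. ennreal (total_deviation n \<omega>) + ?T n) \<longlonglongrightarrow> 0"
    using tendsto_add[OF tendsto_ennrealI[OF elim] mean_histogram_L1] by simp
  show ?case
  proof (rule tendsto_sandwich[OF _ _ tendsto_const lim])
    show "eventually (\<lambda>n. (\<integral>\<^sup>+x. ennreal \<bar>private_histogram (A n) (N n) (h n) s X \<zeta> n x \<omega> - f x\<bar> \<partial>lborel) \<le>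
        ennreal (total_deviation n \<omega>) + ?T n) sequentially"
      using eventually_ge_at_top[of 1]
    proof eventually_elim
      case n: (elim n)
      note part = partition[OF n]
      have h: "h n > 0" using h_pos n .
      let ?a = "\<lambda>j. \<bar>estimate n j \<omega> - cell_prob (A n j)\<bar>"
      let ?S = "\<lambda>x. (\<Sum>j=1..N n. ?a j / h n ^ CARD('n) * indicator (A n j) x)"
      have S_nonneg: "?S x \<ge> 0" for x
        using h by (intro sum_nonneg mult_nonneg_nonneg) auto
      have "(\<integral>\<^sup>+x. ennreal \<bar>private_histogram (A n) (N n) (h n) s X \<zeta> n x \<omega> - f x\<bar> \<partial>lborel) \<le>
        (\<integral>\<^sup>+x. ennreal (?S x) + ennreal \<bar>mean_histogram n x - f x\<bar> \<partial>lborel)"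
      proof (rule nn_integral_mono)
        fix x
        \<comment> \<open>Equality, not just an upper bound: at each x at most one cell contributes,
          so the absolute value passes inside the sum.\<close>
        have "\<bar>private_histogram (A n) (N n) (h n) s X \<zeta> n x \<omega> - mean_histogram n x\<bar> = ?S x"
          unfolding mean_histogram_def private_histogram_eq_sum[OF part] sum_indicator_cells[OF part]
          using h by (simp add: diff_divide_distrib[symmetric] abs_divide)
        then have "\<bar>private_histogram (A n) (N n) (h n) s X \<zeta> n x \<omega> - f x\<bar> \<le> ?S x + \<bar>mean_histogram n x - f x\<bar>"
          by linarith
        then show "ennreal \<bar>private_histogram (A n) (N n) (h n) s X \<zeta> n x \<omega> - f x\<bar> \<le>
            ennreal (?S x) + ennreal \<bar>mean_histogram n x - f x\<bar>"
          using S_nonneg by (simp add: ennreal_leI flip: ennreal_plus)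
      qed
      also have "\<dots> = (\<integral>\<^sup>+x. ennreal (?S x) \<partial>lborel) + ?T n"
      proof (rule nn_integral_add)
        have "?S \<in> borel_measurable borel"
          using cell_sets[OF n] by (intro borel_measurable_sum) auto
        then show "(\<lambda>x. ennreal (?S x)) \<in> borel_measurable lborel" by simp
        show "(\<lambda>x. ennreal \<bar>mean_histogram n x - f x\<bar>) \<in> borel_measurable lborel"
          using mean_histogram_measurable[OF n] by simp
      qed
      also have "(\<integral>\<^sup>+x. ennreal (?S x) \<partial>lborel) = ennreal (total_deviation n \<omega>)"
        unfolding total_deviation_def by (rule nn_integral_cells[OF n]) simp
      finally show ?case .
    qed
  qed simp
qed

end

theorem theorem3p1:
  fixes M :: "'w measure"
    and X :: "nat \<Rightarrow> 'w \<Rightarrow> real ^ 'n"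
    and \<zeta> :: "nat \<Rightarrow> nat \<Rightarrow> 'w \<Rightarrow> real"
    and f :: "real ^ 'n \<Rightarrow> real"
    and \<alpha> :: real
    and h r :: "nat \<Rightarrow> real"
    and A :: "nat \<Rightarrow> nat \<Rightarrow> (real ^ 'n) set"
    and N :: "nat \<Rightarrow> nat"
    and ftilde :: "nat \<Rightarrow> real ^ 'n \<Rightarrow> 'w \<Rightarrow> real"
  defines "ftilde \<equiv> \<lambda>n. private_histogram (A n) (N n) (h n) (noise_level \<alpha>) X \<zeta> n"
  assumes "prob_space M"
    and "\<alpha> > 0"
    and "\<And>n. n \<ge> 1 \<Longrightarrow> h n > 0"
    and "\<And>n. n \<ge> 1 \<Longrightarrow> r n > 0"
    and "\<And>n. n \<ge> 1 \<Longrightarrow> cubic_partition (h n) (A n)"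
    and "\<And>n j. n \<ge> 1 \<Longrightarrow> j \<ge> 1 \<Longrightarrow> A n j \<inter> cball 0 (r n) \<noteq> {} \<longleftrightarrow> j \<le> N n"
    and "\<And>x. f x \<ge> 0"
    and "\<And>i. i \<ge> 1 \<Longrightarrow> distributed M lborel (X i) (\<lambda>x. ennreal (f x))"
    and "prob_space.indep_vars M (\<lambda>_. borel) X {1..}"
    and "\<And>i j. i \<ge> 1 \<Longrightarrow> j \<ge> 1 \<Longrightarrow>
           distributed M lborel (\<zeta> i j) (\<lambda>x. ennreal (laplace_density x))"
    and "prob_space.indep_vars M (\<lambda>_. borel) (\<lambda>(i, j). \<zeta> i j) ({1..} \<times> {1..})"
    and "prob_space.indep_set M (generated_sigma M {1..} X)
           (generated_sigma M ({1..} \<times> {1..}) (\<lambda>(i, j). \<zeta> i j))"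
    and "filterlim r at_top sequentially"
    and "h \<longlonglongrightarrow> 0"
    and "filterlim (\<lambda>n. real n * h n ^ (2 * CARD('n)) / ln (real n)) at_top sequentially"
  shows "(AE x in lborel. AE \<omega> in M. (\<lambda>n. ftilde n x \<omega>) \<longlonglongrightarrow> f x) \<and>
    (filterlim (\<lambda>n. real n * h n ^ (2 * CARD('n)) / (r n ^ (2 * CARD('n)) * ln (real n)))
         at_top sequentially \<longrightarrow>
      (AE \<omega> in M. (\<lambda>n. \<integral>\<^sup>+ x. ennreal \<bar>ftilde n x \<omega> - f x\<bar> \<partial>lborel) \<longlonglongrightarrow> 0))"
proof -
  interpret prob_space M by fact
  interpret privatised_histogram M X \<zeta> f "noise_level \<alpha>" h r A N
  proof unfold_locales
    show "noise_level \<alpha> > 0" using \<open>\<alpha> > 0\<close> by (simp add: noise_level_def)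
  qed (fact assms)+
  show ?thesis
    unfolding ftilde_def using private_histogram_tendsto private_histogram_L1 by blast
qed

end
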